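(* The language of PC-BDMCs (and thus also the language of PC encodings) is strictly more succinct than the language of generalized PC backdoor trees.
   Context: Succinctness. A language $\mathbf{L}_1$ is at least as succinct as $\mathbf{L}_2$ iff there is a polynomial $p$ such that for every sentence $\varphi\in\mathbf{L}_2$ there is an equivalent sentence (one representing the same boolean function) $\psi\in\mathbf{L}_1$ with $|\psi|\le p(|\varphi|)$. $\mathbf{L}_1$ is strictly more succinct than $\mathbf{L}_2$ if $\mathbf{L}_1$ is at least as succinct as $\mathbf{L}_2$ but $\mathbf{L}_2$ is not at least as succinct as $\mathbf{L}_1$. Formulas. A clause is a set of literals, a CNF formula is a set of clauses. $\mathrm{lit}(\mathbf{x})$ is the set of literals over $\mathbf{x}$. A partial assignment is a set of literals containing no complementary pair; in $\varphi\wedge\alpha$ it is identified with the conjunction of its literals. $\varphi\vdash_1 C$ means that the clause $C$ can be derived from $\varphi$ by unit resolution (in particular if $C\in\varphi$); $\bot$ is the empty clause. A CNF formula $\varphi(\mathbf{x},\mathbf{y})$ is a CNF encoding of $f(\mathbf{x})$ if $f(\mathbf{x})\equiv(\exists\mathbf{y})\varphi(\mathbf{x},\mathbf{y})$; $\mathbf{x}$ are main and $\mathbf{y}$ auxiliary variables. It is propagation complete (PC) if for every partial assignment $\alpha\subseteq\mathrm{lit}(\mathbf{x}\cup\mathbf{y})$ and every $l\in\mathrm{lit}(\mathbf{x}\cup\mathbf{y})$ with $\varphi\wedge\alpha\models l$ we have $\varphi\wedge\alpha\vdash_1 l$ or $\varphi\wedge\alpha\vdash_1\bot$. BDMC. A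 PC-BDMC on variables $\mathbf{x}$ is a rooted directed acyclic graph $D$ with node set $V$ and root $\rho$. Inner nodes are labeled $\wedge$ or $\vee$ and have arbitrarily many successors (edges go from a gate to its inputs). The leaves are in one-to-one correspondence with PC encodings $\varphi_i(\mathbf{x}_i,\mathbf{y}_i)$, $i=1,\dots,\ell$, with main variables $\mathbf{x}_i\subseteq\mathbf{x}$ and pairwise disjoint sets of auxiliary variables $\mathbf{y}_i$. For $v\in V$, $\mathrm{var}(v)$ is the union of $\mathbf{x}_i$ over the leaves reachable from $v$; $\mathrm{var}(\rho)=\mathbf{x}$ is required. Decomposability: for every $\wedge$-node $v=v_1\wedge\dots\wedge v_k$ the sets $\mathrm{var}(v_1),\dots,\mathrm{var}(v_k)$ are pairwise disjoint. A leaf with $\varphi_i$ represents $(\exists\mathbf{y}_i)\varphi_i(\mathbf{x}_i,\mathbf{y}_i)$; a $\wedge$-node ($\vee$-node) represents the conjunction (disjunction) of the functions of its successors; $D$ represents the function of its root. A generalized PC backdoor tree is a PC-BDMC in which the only gates allowed in the circuit part are decision gates (a decision gate on a variable $x$ is a disjunction of two conjunctions $(x\wedge A)\vee(\neg x\wedge B)$), the directed graph of the circuit part is an out-arborescence, and the leaves are associated with PC formulas without auxiliary variables. Equivalently, it is a decision tree each of whose leaves carries a PC formula (without auxiliary variables) representing the restriction of the represented function by the assignments on the path from the root to that leaf. The size of a PC-BDMC or of a generalized PC backdoor tree is the number of edges in the circuit part plus the sum of the sizes of the formulas associated with the leaves. *)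

theory Defs
  imports
    "HOL-Computational_Algebra.Polynomial"
    "HOL-Library.Disjoint_Sets"
begin

section \<open>CNF formulas and unit resolution\<close>

type_synonym var = nat

datatype lit = Pos var | Neg var

fun compl :: "lit \<Rightarrow> lit" where
  "compl (Pos v) = Neg v"
| "compl (Neg v) = Pos v"

definition lits :: "var set \<Rightarrow> lit set" where
  "lits X = Pos ` X \<union> Neg ` X"

type_synonym clause = "lit set"
type_synonym cnf = "clause set"
type_synonym assignment = "var \<Rightarrow> bool"

fun lit_true :: "assignment \<Rightarrow> lit \<Rightarrow> bool" where
  "lit_true a (Pos v) \<longleftrightarrow> a v"
| "lit_true a (Neg v) \<longleftrightarrow> \<not> a v"

definition satisfies :: "assignment \<Rightarrow> cnf \<Rightarrow> bool" where
  "satisfies a \<phi> \<longleftrightarrow> (\<forall>C\<in>\<phi>. \<exists>l\<in>C. lit_true a l)"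

definition entails :: "cnf \<Rightarrow> lit \<Rightarrow> bool" where
  "entails \<phi> l \<longleftrightarrow> (\<forall>a. satisfies a \<phi> \<longrightarrow> lit_true a l)"

inductive unit_derives :: "cnf \<Rightarrow> clause \<Rightarrow> bool" for \<phi> :: cnf where
  axiom: "C \<in> \<phi> \<Longrightarrow> unit_derives \<phi> C"
| resolve: "unit_derives \<phi> {l} \<Longrightarrow> unit_derives \<phi> C \<Longrightarrow> compl l \<in> C \<Longrightarrow>
    unit_derives \<phi> (C - {compl l})"

definition partial_assignment :: "lit set \<Rightarrow> bool" where
  "partial_assignment \<alpha> \<longleftrightarrow> (\<forall>l\<in>\<alpha>. compl l \<notin> \<alpha>)"

definition conj_lits :: "cnf \<Rightarrow> lit set \<Rightarrow> cnf" where
  "conj_lits \<phi> \<alpha> = \<phi> \<union> {{l} | l. l \<in> \<alpha>}"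

text \<open>The size of a CNF formula is its length, the total number of occurrences of literals.\<close>

definition cnf_size :: "cnf \<Rightarrow> nat" where
  "cnf_size \<phi> = (\<Sum>C\<in>\<phi>. card C)"


section \<open>Boolean functions\<close>

text \<open>
  A boolean function \<open>f(X)\<close> is a pair of its finite set of variables \<open>X\<close> and a predicate on total
  assignments that depends only on the values of the variables in \<open>X\<close>. All functions represented
  below have this property, so that equality of such pairs is equality of boolean functions
  (including their sets of variables).
\<close>

type_synonym boolfun = "var set \<times> (assignment \<Rightarrow> bool)"


section \<open>Propagation complete encodings\<close>

text \<open>
  An encoding \<open>\<phi>(X,Y)\<close> carries its main variables \<open>X\<close> and its auxiliary variables \<open>Y\<close>; some of
  them may have no occurrence in \<open>\<phi>\<close>.
\<close>

record encoding =
  main :: "var set"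
  aux :: "var set"
  clauses :: cnf

definition cnf_encoding :: "encoding \<Rightarrow> bool" where
  "cnf_encoding e \<longleftrightarrow> finite (main e) \<and> finite (aux e) \<and> main e \<inter> aux e = {} \<and>
     (\<forall>C\<in>clauses e. C \<subseteq> lits (main e \<union> aux e))"

definition encoding_holds :: "encoding \<Rightarrow> assignment \<Rightarrow> bool" where
  "encoding_holds e a \<longleftrightarrow> (\<exists>b. (\<forall>v\<in>main e. b v = a v) \<and> satisfies b (clauses e))"

definition propagation_complete :: "encoding \<Rightarrow> bool" where
  "propagation_complete e \<longleftrightarrow>
     (\<forall>\<alpha> l. \<alpha> \<subseteq> lits (main e \<union> aux e) \<longrightarrow> partial_assignment \<alpha> \<longrightarrow> l \<in> lits (main e \<union> aux e) \<longrightarrow>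
        entails (conj_lits (clauses e) \<alpha>) l \<longrightarrow>
        unit_derives (conj_lits (clauses e) \<alpha>) {l} \<or> unit_derives (conj_lits (clauses e) \<alpha>) {})"

definition pc_encoding :: "encoding \<Rightarrow> bool" where
  "pc_encoding e \<longleftrightarrow> cnf_encoding e \<and> propagation_complete e"

definition encoding_fun :: "encoding \<Rightarrow> boolfun" where
  "encoding_fun e = (main e, encoding_holds e)"

definition encoding_size :: "encoding \<Rightarrow> nat" where
  "encoding_size e = cnf_size (clauses e)"


section \<open>PC-BDMCs\<close>

datatype node = And | Or | Leaf (leaf_enc: encoding)

record bdmc =
  nodes :: "nat set"
  edges :: "(nat \<times> nat) set"
  root :: nat
  label :: "nat \<Rightarrow> node"

definition succs :: "bdmc \<Rightarrow> nat \<Rightarrow> nat set" where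
  "succs D v = {w. (v, w) \<in> edges D}"

definition leaves :: "bdmc \<Rightarrow> nat set" where
  "leaves D = {v \<in> nodes D. succs D v = {}}"

abbreviation leaf :: "bdmc \<Rightarrow> nat \<Rightarrow> encoding" where
  "leaf D v \<equiv> leaf_enc (label D v)"

definition rooted_dag :: "bdmc \<Rightarrow> bool" where
  "rooted_dag D \<longleftrightarrow> finite (nodes D) \<and> edges D \<subseteq> nodes D \<times> nodes D \<and> acyclic (edges D) \<and>
     root D \<in> nodes D \<and> (\<forall>v\<in>nodes D. (root D, v) \<in> (edges D)\<^sup>*)"

definition var_of :: "bdmc \<Rightarrow> nat \<Rightarrow> var set" where
  "var_of D v = (\<Union>w \<in> {w \<in> leaves D. (v, w) \<in> (edges D)\<^sup>*}. main (leaf D w))"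

text \<open>
  The one-to-one correspondence of leaves and encodings is the indexed family \<open>leaf D\<close>: distinct
  leaves are distinct occurrences of encodings, which may be the same formula (for instance, the
  same literal), provided that auxiliary variables are not shared. The set of variables of \<open>D\<close> is
  by definition \<open>var_of D (root D)\<close>. No variable is both a main variable of \<open>D\<close> and auxiliary.
\<close>

definition pc_bdmc :: "bdmc \<Rightarrow> bool" where
  "pc_bdmc D \<longleftrightarrow> rooted_dag D \<and>
     (\<forall>v\<in>nodes D. is_Leaf (label D v) \<longleftrightarrow> v \<in> leaves D) \<and>
     (\<forall>v\<in>leaves D. pc_encoding (leaf D v)) \<and>
     disjoint_family_on (\<lambda>v. aux (leaf D v)) (leaves D) \<and>
     (\<forall>v\<in>leaves D. aux (leaf D v) \<inter> var_of D (root D) = {}) \<and>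
     (\<forall>v\<in>nodes D. label D v = And \<longrightarrow> disjoint_family_on (var_of D) (succs D v))"

text \<open>
  The graph is finite and acyclic, so the least fixed point defined here is the only solution of
  the equations that determine the values of the nodes from those of their successors.
\<close>

inductive node_holds :: "bdmc \<Rightarrow> assignment \<Rightarrow> nat \<Rightarrow> bool"
  for D :: bdmc and a :: assignment where
  leaf: "label D v = Leaf e \<Longrightarrow> encoding_holds e a \<Longrightarrow> node_holds D a v"
| disj: "label D v = Or \<Longrightarrow> w \<in> succs D v \<Longrightarrow> node_holds D a w \<Longrightarrow> node_holds D a v"
| conj: "label D v = And \<Longrightarrow> (\<And>w. w \<in> succs D v \<Longrightarrow> node_holds D a w) \<Longrightarrow> node_holds D a v"

definition bdmc_fun :: "bdmc \<Rightarrow> boolfun" where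
  "bdmc_fun D = (var_of D (root D), \<lambda>a. node_holds D a (root D))"

definition bdmc_size :: "bdmc \<Rightarrow> nat" where
  "bdmc_size D = card (edges D) + (\<Sum>v\<in>leaves D. encoding_size (leaf D v))"


section \<open>Generalized PC backdoor trees\<close>

definition out_arborescence :: "bdmc \<Rightarrow> bool" where
  "out_arborescence D \<longleftrightarrow> rooted_dag D \<and> (\<forall>u. (u, root D) \<notin> edges D) \<and>
     (\<forall>v\<in>nodes D - {root D}. \<exists>!u. (u, v) \<in> edges D)"

fun lit_encoding :: "lit \<Rightarrow> encoding" where
  "lit_encoding (Pos v) = \<lparr>main = {v}, aux = {}, clauses = {{Pos v}}\<rparr>"
| "lit_encoding (Neg v) = \<lparr>main = {v}, aux = {}, clauses = {{Neg v}}\<rparr>"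

definition conj_with_lit :: "bdmc \<Rightarrow> lit \<Rightarrow> nat \<Rightarrow> bool" where
  "conj_with_lit D l u \<longleftrightarrow> label D u = And \<and>
     (\<exists>c d. c \<noteq> d \<and> succs D u = {c, d} \<and> label D c = Leaf (lit_encoding l))"

definition decision_gate :: "bdmc \<Rightarrow> nat \<Rightarrow> bool" where
  "decision_gate D v \<longleftrightarrow> label D v = Or \<and>
     (\<exists>x u w. u \<noteq> w \<and> succs D v = {u, w} \<and> conj_with_lit D (Pos x) u \<and> conj_with_lit D (Neg x) w)"

text \<open>
  A decision gate \<open>(x \<and> A) \<or> (\<not>x \<and> B)\<close> consists of a \<open>\<or>\<close>-node and two \<open>\<and>\<close>-nodes. Hence the gates
  are exactly those of decision gates if every \<open>\<or>\<close>-node is the top of a decision gate and every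
  \<open>\<and>\<close>-node is a successor of such a node; in an arborescence it then follows that each of \<open>A\<close> and
  \<open>B\<close> is a leaf or a decision gate.
\<close>

definition gen_pc_backdoor_tree :: "bdmc \<Rightarrow> bool" where
  "gen_pc_backdoor_tree D \<longleftrightarrow> pc_bdmc D \<and> out_arborescence D \<and>
     (\<forall>v\<in>nodes D. label D v = Or \<longrightarrow> decision_gate D v) \<and>
     (\<forall>v\<in>nodes D. label D v = And \<longrightarrow> (\<exists>u\<in>nodes D. decision_gate D u \<and> v \<in> succs D u)) \<and>
     (\<forall>v\<in>leaves D. aux (leaf D v) = {})"


section \<open>Languages and succinctness\<close>

record 's language =
  sentences :: "'s set"
  sentence_size :: "'s \<Rightarrow> nat"
  represents :: "'s \<Rightarrow> boolfun"

definition at_least_as_succinct :: "'s language \<Rightarrow> 't language \<Rightarrow> bool" where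
  "at_least_as_succinct L1 L2 \<longleftrightarrow> (\<exists>p :: real poly. \<forall>\<phi>\<in>sentences L2. \<exists>\<psi>\<in>sentences L1.
     represents L1 \<psi> = represents L2 \<phi> \<and>
     real (sentence_size L1 \<psi>) \<le> poly p (real (sentence_size L2 \<phi>)))"

definition strictly_more_succinct :: "'s language \<Rightarrow> 't language \<Rightarrow> bool" where
  "strictly_more_succinct L1 L2 \<longleftrightarrow>
     at_least_as_succinct L1 L2 \<and> \<not> at_least_as_succinct L2 L1"

definition PC_encodings :: "encoding language" where
  "PC_encodings =
     \<lparr>sentences = {e. pc_encoding e}, sentence_size = encoding_size, represents = encoding_fun\<rparr>"

definition PC_BDMCs :: "bdmc language" where
  "PC_BDMCs = \<lparr>sentences = {D. pc_bdmc D}, sentence_size = bdmc_size, represents = bdmc_fun\<rparr>"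

definition gen_PC_backdoor_trees :: "bdmc language" where
  "gen_PC_backdoor_trees =
     \<lparr>sentences = {D. gen_pc_backdoor_tree D}, sentence_size = bdmc_size, represents = bdmc_fun\<rparr>"

end

theory Submission
  imports Defs "HOL-Library.Nat_Bijection"
begin

text \<open>
  A generalized PC backdoor tree is a disjunction of PC formulas without auxiliary variables, one
  for each leaf: the formula of the leaf together with the unit clauses of its path. A disjunction
  of PC formulas has a PC encoding of polynomial size, built from selectors of the disjuncts and
  from a copy of the literals for each disjunct. Single-leaf circuits turn PC encodings into
  PC-BDMCs.

  For the separation, parity of \<open>n\<close> variables has a PC encoding of linear size, a chain of binary
  exclusive ors. Every nontautological clause of a CNF formula for parity without auxiliary variables excludes
  exactly one assignment. A decision on a variable leaves parity of the remaining variables, which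
  halves the number of excluded assignments but doubles the number of formulas. So every tree for
  parity has exponential size.
\<close>

section \<open>Propagation completeness via closed sets of literals\<close>

text \<open>Derivations are awkward to argue about, so propagation completeness is turned into a
  statement on sets of literals closed under propagation: every literal missing from such a set is
  false in some model that extends the set. Proving or using completeness then means constructing or
  receiving models. The closed sets may assign auxiliary variables in any way, and this shapes the
  encoding of a disjunction. Guarding every formula by its selector would not do: while no selector
  is set, a guarded clause can at most refute its selector, and a literal implied by all disjuncts
  would be missed. The copies let propagation run in all disjuncts side by side, without deciding
  between them. The lower bound depends on leaves without auxiliary variables, since parity is easy
  with them; decisions do not help because parity restricted by an assignment is again parity or its
  negation.\<close>

lemma compl_compl [simp]: "compl (compl l) = l"
  by (cases l) auto

lemma lit_true_compl [simp]: "lit_true a (compl l) \<longleftrightarrow> \<not> lit_true a l"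
  by (cases l) auto

lemma compl_in_lits [simp]: "compl l \<in> lits X \<longleftrightarrow> l \<in> lits X"
  by (cases l) (auto simp: lits_def)

lemma in_lits [simp]: "Pos v \<in> lits X \<longleftrightarrow> v \<in> X" "Neg v \<in> lits X \<longleftrightarrow> v \<in> X"
  by (auto simp: lits_def)

lemma finite_lits [simp]: "finite X \<Longrightarrow> finite (lits X)"
  by (simp add: lits_def)

lemma lits_mono: "X \<subseteq> Y \<Longrightarrow> lits X \<subseteq> lits Y"
  by (auto simp: lits_def)

lemma card_lits_le: "finite X \<Longrightarrow> card (lits X) \<le> 2 * card X"
  unfolding lits_def by (intro order.trans[OF card_Un_le]) (simp add: card_image_le add_mono mult_2)

lemma lit_true_cong: "l \<in> lits X \<Longrightarrow> (\<And>v. v \<in> X \<Longrightarrow> a v = b v) \<Longrightarrow> lit_true a l = lit_true b l"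
  by (cases l) auto

lemma satisfies_cong:
  assumes "\<forall>C\<in>\<phi>. C \<subseteq> lits X" "\<And>v. v \<in> X \<Longrightarrow> a v = b v"
  shows "satisfies a \<phi> = satisfies b \<phi>"
proof -
  have "lit_true a l = lit_true b l" if "C \<in> \<phi>" "l \<in> C" for C l
    using that assms by (intro lit_true_cong[of _ X]) auto
  then show ?thesis
    unfolding satisfies_def by blast
qed

text \<open>
  The sets \<open>\<beta>\<close> closed under unit propagation that yield no contradiction. The empty clause has to be
  excluded separately: in every other clause falsified by \<open>\<beta>\<close>, some literal is propagated and makes
  \<open>\<beta>\<close> inconsistent.
\<close>

definition up_closed :: "cnf \<Rightarrow> lit set \<Rightarrow> bool" where
  "up_closed \<phi> \<beta> \<longleftrightarrow> partial_assignment \<beta> \<and> {} \<notin> \<phi> \<and>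
     (\<forall>C\<in>\<phi>. \<forall>l\<in>C. (\<forall>m\<in>C - {l}. compl m \<in> \<beta>) \<longrightarrow> l \<in> \<beta>)"

lemma up_closedD:
  "up_closed \<phi> \<beta> \<Longrightarrow> C \<in> \<phi> \<Longrightarrow> l \<in> C \<Longrightarrow> (\<And>m. m \<in> C \<Longrightarrow> m \<noteq> l \<Longrightarrow> compl m \<in> \<beta>) \<Longrightarrow> l \<in> \<beta>"
  by (auto simp: up_closed_def)

lemma up_closed_consistent: "up_closed \<phi> \<beta> \<Longrightarrow> l \<in> \<beta> \<Longrightarrow> compl l \<notin> \<beta>"
  by (auto simp: up_closed_def partial_assignment_def)

lemma unit_derives_diff:
  assumes "finite D" "unit_derives \<phi> C" "D \<subseteq> C" "\<And>m. m \<in> D \<Longrightarrow> unit_derives \<phi> {compl m}"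
  shows "unit_derives \<phi> (C - D)"
  using assms
proof (induction D rule: finite_induct)
  case (insert m D)
  then have D: "unit_derives \<phi> (C - D)" and m: "unit_derives \<phi> {compl m}"
    by auto
  have "unit_derives \<phi> (C - D - {compl (compl m)})"
    by (rule unit_derives.resolve[OF m D]) (use insert in auto)
  then show ?case
    by (simp add: Diff_insert[of C m D])
qed simp

lemma unit_derives_subset:
  assumes "unit_derives \<phi> C" "\<forall>C\<in>\<phi>. C \<subseteq> L"
  shows "C \<subseteq> L"
  using assms by induction auto

text \<open>Resolving with a derived unit removes a literal that is false under
  \<open>\<beta>\<close>: by the invariant the unit comes from a clause whose other literals are
  false, so closedness puts it in \<open>\<beta>\<close>. Hence propagation from a closed set only
  deletes false literals from the given clauses.\<close>

lemma unit_derives_up_closed: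
  assumes "unit_derives (conj_lits \<phi> \<beta>) C" "up_closed \<phi> \<beta>"
  shows "\<exists>C'\<in>conj_lits \<phi> \<beta>. C \<subseteq> C' \<and> (\<forall>m\<in>C' - C. compl m \<in> \<beta>)"
  using assms(1)
proof induction
  case (axiom C)
  then show ?case by blast
next
  case (resolve l C)
  then obtain C1 C2 where C1: "C1 \<in> conj_lits \<phi> \<beta>" "l \<in> C1" "\<forall>m\<in>C1 - {l}. compl m \<in> \<beta>"
    and C2: "C2 \<in> conj_lits \<phi> \<beta>" "C \<subseteq> C2" "\<forall>m\<in>C2 - C. compl m \<in> \<beta>"
    by auto
  have "l \<in> \<beta>"
    using C1 up_closedD[OF assms(2)] by (auto simp: conj_lits_def)
  then show ?case
    using C2 by (intro bexI[of _ C2]) auto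
qed

lemma satisfies_conj_lits:
  "satisfies a (conj_lits \<phi> \<alpha>) \<longleftrightarrow> satisfies a \<phi> \<and> (\<forall>m\<in>\<alpha>. lit_true a m)"
  by (auto simp: satisfies_def conj_lits_def)

text \<open>From a closed set, propagation derives neither an absent literal nor the empty clause,
  so completeness forbids that the literal is entailed. Conversely, if propagation from
  \<open>\<alpha>\<close> yields no contradiction, the units it derives form a closed set containing
  \<open>\<alpha>\<close>, and a model of that set refutes the entailment of any underived
  literal.\<close>

lemma propagation_complete_iff:
  assumes "cnf_encoding e"
  defines "V \<equiv> main e \<union> aux e"
  shows "propagation_complete e \<longleftrightarrow>
    (\<forall>\<beta>\<subseteq>lits V. up_closed (clauses e) \<beta> \<longrightarrow> (\<forall>l\<in>lits V - \<beta>.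
       \<exists>a. satisfies a (clauses e) \<and> (\<forall>m\<in>\<beta>. lit_true a m) \<and> \<not> lit_true a l))"
    (is "_ \<longleftrightarrow> ?R")
proof
  assume pc: "propagation_complete e"
  show ?R
  proof (intro allI impI ballI)
    fix \<beta> l
    assume \<beta>: "\<beta> \<subseteq> lits V" "up_closed (clauses e) \<beta>" and l: "l \<in> lits V - \<beta>"
    have "\<not> unit_derives (conj_lits (clauses e) \<beta>) {l}"
    proof
      assume "unit_derives (conj_lits (clauses e) \<beta>) {l}"
      from unit_derives_up_closed[OF this \<beta>(2)] obtain C
        where "C \<in> conj_lits (clauses e) \<beta>" "l \<in> C" "\<forall>m\<in>C - {l}. compl m \<in> \<beta>"
        by auto
      then have "l \<in> \<beta>"
        using up_closedD[OF \<beta>(2)] by (auto simp: conj_lits_def)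
      then show False using l by simp
    qed
    moreover have "\<not> unit_derives (conj_lits (clauses e) \<beta>) {}"
    proof
      assume "unit_derives (conj_lits (clauses e) \<beta>) {}"
      from unit_derives_up_closed[OF this \<beta>(2)] obtain C
        where C: "C \<in> conj_lits (clauses e) \<beta>" "\<forall>m\<in>C. compl m \<in> \<beta>"
        by auto
      moreover have "C \<noteq> {}"
        using C(1) \<beta>(2) by (auto simp: conj_lits_def up_closed_def)
      then obtain g where "g \<in> C" by blast
      ultimately have "g \<in> \<beta>"
        using up_closedD[OF \<beta>(2), of C g] by (auto simp: conj_lits_def)
      with C(2) \<open>g \<in> C\<close> show False
        using up_closed_consistent[OF \<beta>(2)] by blast
    qed
    moreover have "partial_assignment \<beta>"
      using \<beta>(2) by (simp add: up_closed_def)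
    ultimately have "\<not> entails (conj_lits (clauses e) \<beta>) l"
      using pc \<beta>(1) l unfolding propagation_complete_def V_def by blast
    then show "\<exists>a. satisfies a (clauses e) \<and> (\<forall>m\<in>\<beta>. lit_true a m) \<and> \<not> lit_true a l"
      by (auto simp: entails_def satisfies_conj_lits)
  qed
next
  assume R: ?R
  show "propagation_complete e"
    unfolding propagation_complete_def V_def[symmetric]
  proof (intro allI impI)
    fix \<alpha> l
    assume \<alpha>: "\<alpha> \<subseteq> lits V" and l: "l \<in> lits V" and ent: "entails (conj_lits (clauses e) \<alpha>) l"
    define \<psi> where "\<psi> = conj_lits (clauses e) \<alpha>"
    define \<beta> where "\<beta> = {m. unit_derives \<psi> {m}}"
    have sub: "\<forall>C\<in>\<psi>. C \<subseteq> lits V"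
      using assms \<alpha> by (auto simp: \<psi>_def conj_lits_def cnf_encoding_def)
    have fin: "finite (lits V)"
      using assms by (simp add: cnf_encoding_def)
    have "\<beta> \<subseteq> lits V"
      using unit_derives_subset[OF _ sub] by (auto simp: \<beta>_def)
    have "\<alpha> \<subseteq> \<beta>"
      by (auto simp: \<beta>_def \<psi>_def conj_lits_def intro: unit_derives.axiom)
    show "unit_derives \<psi> {l} \<or> unit_derives \<psi> {}"
    proof (rule ccontr)
      assume neg: "\<not> (unit_derives \<psi> {l} \<or> unit_derives \<psi> {})"
      have "up_closed (clauses e) \<beta>"
        unfolding up_closed_def partial_assignment_def
      proof (intro conjI ballI impI)
        show "compl m \<notin> \<beta>" if "m \<in> \<beta>" for m
          using unit_derives.resolve[of \<psi> m "{compl m}"] that neg by (auto simp: \<beta>_def)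
        show "{} \<notin> clauses e"
          using neg unit_derives.axiom[of "{}" \<psi>] by (auto simp: \<psi>_def conj_lits_def)
        fix C g assume C: "C \<in> clauses e" "g \<in> C" "\<forall>m\<in>C - {g}. compl m \<in> \<beta>"
        have "C \<in> \<psi>" using C by (simp add: \<psi>_def conj_lits_def)
        then have "unit_derives \<psi> (C - (C - {g}))"
          using C sub fin
          by (intro unit_derives_diff) (auto simp: \<beta>_def intro: unit_derives.axiom finite_subset)
        moreover have "C - (C - {g}) = {g}" using C by auto
        ultimately show "g \<in> \<beta>" by (simp add: \<beta>_def)
      qed
      moreover have "l \<notin> \<beta>" using neg by (simp add: \<beta>_def)
      ultimately obtain a where "satisfies a (clauses e)" "\<forall>m\<in>\<beta>. lit_true a m" "\<not> lit_true a l"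
        using R \<open>\<beta> \<subseteq> lits V\<close> l by blast
      then show False
        using ent \<open>\<alpha> \<subseteq> \<beta>\<close> by (auto simp: entails_def satisfies_conj_lits)
    qed
  qed
qed

lemma pc_encoding_model_not:
  assumes "pc_encoding e" "\<beta> \<subseteq> lits (main e \<union> aux e)" "up_closed (clauses e) \<beta>"
    "l \<in> lits (main e \<union> aux e)" "l \<notin> \<beta>"
  obtains a where "satisfies a (clauses e)" "\<forall>m\<in>\<beta>. lit_true a m" "\<not> lit_true a l"
  using assms propagation_complete_iff[of e] unfolding pc_encoding_def by blast

text \<open>Completeness yields a model only by way of an absent literal. By consistency there is
  one as soon as there is a variable; without variables only the empty clause could prevent
  satisfaction, and closedness excludes it.\<close>

lemma pc_encoding_model:
  assumes "pc_encoding e" "\<beta> \<subseteq> lits (main e \<union> aux e)" "up_closed (clauses e) \<beta>"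
  obtains a where "satisfies a (clauses e)" "\<forall>m\<in>\<beta>. lit_true a m"
proof (cases "main e \<union> aux e = {}")
  case True
  then have "\<beta> = {}" using assms by (simp add: lits_def)
  moreover have "clauses e = {}"
  proof -
    have "\<forall>C\<in>clauses e. C \<subseteq> {}"
      using assms(1) True by (simp add: pc_encoding_def cnf_encoding_def lits_def)
    moreover have "{} \<notin> clauses e"
      using assms(3) by (simp add: up_closed_def)
    ultimately show ?thesis by auto
  qed
  ultimately show ?thesis using that by (simp add: satisfies_def)
next
  case False
  then obtain v where v: "v \<in> main e \<union> aux e" by blast
  have "Pos v \<notin> \<beta> \<or> Neg v \<notin> \<beta>"
    using up_closed_consistent[OF assms(3), of "Pos v"] by auto
  then show ?thesis
  proof
    assume "Pos v \<notin> \<beta>"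
    show ?thesis
      by (rule pc_encoding_model_not[OF assms, of "Pos v"]) (use v \<open>Pos v \<notin> \<beta>\<close> that in auto)
  next
    assume "Neg v \<notin> \<beta>"
    show ?thesis
      by (rule pc_encoding_model_not[OF assms, of "Neg v"]) (use v \<open>Neg v \<notin> \<beta>\<close> that in auto)
  qed
qed

lemma pc_encodingI:
  assumes "cnf_encoding e"
    "\<And>\<beta> l. \<beta> \<subseteq> lits (main e \<union> aux e) \<Longrightarrow> up_closed (clauses e) \<beta> \<Longrightarrow> l \<in> lits (main e \<union> aux e) \<Longrightarrow>
      l \<notin> \<beta> \<Longrightarrow> \<exists>a. satisfies a (clauses e) \<and> (\<forall>m\<in>\<beta>. lit_true a m) \<and> \<not> lit_true a l"
  shows "pc_encoding e"
  using assms propagation_complete_iff[of e] by (auto simp: pc_encoding_def)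

fun lit_var :: "lit \<Rightarrow> var" where
  "lit_var (Pos v) = v"
| "lit_var (Neg v) = v"

lemma in_lits_iff: "l \<in> lits X \<longleftrightarrow> lit_var l \<in> X"
  by (cases l) auto

lemma up_closed_restrict:
  assumes "up_closed \<phi> \<beta>" "\<psi> \<subseteq> \<phi>" "\<forall>C\<in>\<psi>. C \<subseteq> L" "\<And>l. compl l \<in> L \<longleftrightarrow> l \<in> L"
  shows "up_closed \<psi> (\<beta> \<inter> L)"
  using assms unfolding up_closed_def partial_assignment_def by (auto simp: subset_iff)

text \<open>Indexing by a truth value turns the signs in exclusive-or clauses into boolean
  expressions.\<close>

definition lit_of :: "var \<Rightarrow> bool \<Rightarrow> lit" where
  "lit_of v b = (if b then Pos v else Neg v)"

lemma compl_lit_of [simp]: "compl (lit_of v b) = lit_of v (\<not> b)"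
  by (simp add: lit_of_def)

lemma lit_true_lit_of [simp]: "lit_true a (lit_of v b) \<longleftrightarrow> a v = b"
  by (simp add: lit_of_def)

lemma lit_of_in_lits [simp]: "lit_of v b \<in> lits X \<longleftrightarrow> v \<in> X"
  by (simp add: lit_of_def)

lemma lit_of_eq_iff [simp]: "lit_of v b = lit_of w c \<longleftrightarrow> v = w \<and> b = c"
  by (auto simp: lit_of_def)

lemma lit_cases_of: obtains v b where "l = lit_of v b"
  by (cases l) (auto simp: lit_of_def intro: that[of _ True] that[of _ False])

text \<open>Variables outside \<open>X\<close> are unconstrained, so they follow
  \<open>\<beta>\<close>, except that the variable of \<open>l\<close> is set to falsify
  \<open>l\<close>; this agrees with \<open>\<beta>\<close> because \<open>l\<close> is absent from
  it.\<close>

lemma extend_off_main: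
  assumes "satisfies a \<phi>" "\<forall>m\<in>\<beta> \<inter> lits X. lit_true a m" "\<forall>C\<in>\<phi>. C \<subseteq> lits X"
    "partial_assignment \<beta>" "l \<notin> \<beta>" "l \<in> lits X \<longrightarrow> \<not> lit_true a l"
  shows "\<exists>b. (\<forall>v\<in>X. b v = a v) \<and> satisfies b \<phi> \<and> (\<forall>m\<in>\<beta>. lit_true b m) \<and> \<not> lit_true b l"
proof -
  obtain w c where l: "l = lit_of w c" by (rule lit_cases_of)
  define b where "b v = (if v \<in> X then a v else if v = w then \<not> c else Pos v \<in> \<beta>)" for v
  have eq: "\<forall>v\<in>X. b v = a v" by (simp add: b_def)
  then have "satisfies b \<phi>"
    using satisfies_cong[OF assms(3), of b a] assms(1) by simp
  moreover have "lit_true b m" if m: "m \<in> \<beta>" for m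
  proof (cases "m \<in> lits X")
    case True
    then show ?thesis using lit_true_cong[of m X b a] eq assms(2) m by auto
  next
    case False
    obtain v d where "m = lit_of v d" by (rule lit_cases_of)
    with False m show ?thesis
      using assms(4,5) l by (cases d) (auto simp: b_def partial_assignment_def lit_of_def split: if_splits)
  qed
  moreover have "\<not> lit_true b l"
    using assms(6) l by (auto simp: b_def)
  ultimately show ?thesis using eq by blast
qed

text \<open>Serves to give the leaves of a tree, whose formulas have different variables, one common
  set of main variables. The new variables do not occur in \<open>\<phi>\<close>, so the old
  encoding is applied to the part of \<open>\<beta>\<close> over its own variables and the model is
  then extended.\<close>

lemma pc_encoding_extend_main:
  assumes pc: "pc_encoding \<lparr>main = X, aux = Y, clauses = \<phi>\<rparr>"
    and W: "X \<subseteq> W" "finite W" "W \<inter> Y = {}"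
  shows "pc_encoding \<lparr>main = W, aux = Y, clauses = \<phi>\<rparr>"
proof (rule pc_encodingI, goal_cases)
  case 1
  have "C \<subseteq> lits (W \<union> Y)" if "C \<in> \<phi>" for C
    using pc that W lits_mono[of "X \<union> Y" "W \<union> Y"]
    by (fastforce simp: pc_encoding_def cnf_encoding_def)
  then show ?case
    using pc W by (auto simp: pc_encoding_def cnf_encoding_def)
next
  case (2 \<beta> l)
  have sub: "\<forall>C\<in>\<phi>. C \<subseteq> lits (X \<union> Y)"
    using pc by (auto simp: pc_encoding_def cnf_encoding_def)
  have cl: "up_closed \<phi> (\<beta> \<inter> lits (X \<union> Y))"
    using up_closed_restrict[OF _ subset_refl sub] 2 by simp
  define \<gamma> where "\<gamma> = \<beta> \<inter> lits (X \<union> Y)"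
  have "\<exists>a. satisfies a \<phi> \<and> (\<forall>m\<in>\<gamma>. lit_true a m) \<and> (l \<in> lits (X \<union> Y) \<longrightarrow> \<not> lit_true a l)"
  proof (cases "l \<in> lits (X \<union> Y)")
    case True
    show ?thesis
      by (rule pc_encoding_model_not[OF pc, of \<gamma> l]) (use True 2 cl in \<open>auto simp: \<gamma>_def\<close>)
  next
    case False
    show ?thesis
      by (rule pc_encoding_model[OF pc, of \<gamma>]) (use False cl in \<open>auto simp: \<gamma>_def\<close>)
  qed
  moreover have "partial_assignment \<beta>"
    using 2 by (simp add: up_closed_def)
  ultimately show ?case
    using extend_off_main[of _ \<phi> \<beta> "X \<union> Y" l, OF _ _ sub] 2(4) unfolding \<gamma>_def by force
qed

text \<open>Closedness forces \<open>l\<close> into \<open>\<beta>\<close>, so every model of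
  \<open>\<phi>\<close> that extends \<open>\<beta>\<close> satisfies the added unit clause by
  itself.\<close>

lemma pc_encoding_insert_unit:
  assumes pc: "pc_encoding \<lparr>main = X, aux = Y, clauses = \<phi>\<rparr>" and l: "l \<in> lits (X \<union> Y)"
  shows "pc_encoding \<lparr>main = X, aux = Y, clauses = insert {l} \<phi>\<rparr>"
proof (rule pc_encodingI, goal_cases)
  case 1
  then show ?case
    using pc l by (auto simp: pc_encoding_def cnf_encoding_def)
next
  case (2 \<beta> k)
  then have "up_closed \<phi> \<beta>" "l \<in> \<beta>"
    by (auto simp: up_closed_def)
  then obtain a where "satisfies a \<phi>" "\<forall>m\<in>\<beta>. lit_true a m" "\<not> lit_true a k"
    using pc_encoding_model_not[OF pc, of \<beta> k] 2 by auto
  then show ?case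
    using \<open>l \<in> \<beta>\<close> by (auto simp: satisfies_def)
qed

section \<open>Disjunctions of PC formulas\<close>

text \<open>Pairing gives each disjunct a block of its own. Within a block, code 0 is the selector,
  and the positive codes \<open>2 * x + 1\<close> and \<open>2 * x + 2\<close> stand for the two
  literals of \<open>x\<close>.\<close>

definition sel :: "nat \<Rightarrow> nat \<Rightarrow> var" where
  "sel N i = N + prod_encode (i, 0)"

fun copy :: "nat \<Rightarrow> nat \<Rightarrow> lit \<Rightarrow> var" where
  "copy N i (Pos x) = N + prod_encode (i, 2 * x + 1)"
| "copy N i (Neg x) = N + prod_encode (i, 2 * x + 2)"

lemma sel_eq_iff [simp]: "sel N i = sel N j \<longleftrightarrow> i = j"
  by (simp add: sel_def)

lemma copy_eq_iff [simp]: "copy N i l = copy N j m \<longleftrightarrow> i = j \<and> l = m"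
  by (cases l; cases m) (auto, presburger+)

lemma sel_neq_copy [simp]: "sel N i \<noteq> copy N j l" "copy N j l \<noteq> sel N i"
  by (cases l; simp add: sel_def)+

lemma sel_ge [simp]: "N \<le> sel N i" "\<not> sel N i < N"
  by (simp_all add: sel_def)

lemma copy_ge [simp]: "N \<le> copy N i l" "\<not> copy N i l < N"
  by (cases l; simp)+

text \<open>
  The variable \<open>sel N i\<close> selects the disjunct \<open>i\<close>, and \<open>copy N i l\<close> says that \<open>i\<close> is selected and \<open>l\<close> is
  true. For a disjunct not known to be selected, the negations of its copies record the literals
  propagated in it, and the clauses \<open>branch\<close> simulate unit propagation on these: if all literals of
  \<open>D\<close> but \<open>g\<close> are impossible in \<open>i\<close>, then so is the complement of \<open>g\<close>. The offset \<open>N\<close> keeps the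
  auxiliary variables apart from the main ones.
\<close>

inductive_set disj_clauses :: "nat \<Rightarrow> var set \<Rightarrow> cnf list \<Rightarrow> cnf"
  for N :: nat and U :: "var set" and \<Phi> :: "cnf list" where
  some_sel: "(\<lambda>i. Pos (sel N i)) ` {..<length \<Phi>} \<in> disj_clauses N U \<Phi>"
| unique_sel: "i < length \<Phi> \<Longrightarrow> j < length \<Phi> \<Longrightarrow> i \<noteq> j \<Longrightarrow>
    {Neg (sel N i), Neg (sel N j)} \<in> disj_clauses N U \<Phi>"
| copy_sel: "i < length \<Phi> \<Longrightarrow> l \<in> lits U \<Longrightarrow> {Neg (copy N i l), Pos (sel N i)} \<in> disj_clauses N U \<Phi>"
| copy_main: "i < length \<Phi> \<Longrightarrow> l \<in> lits U \<Longrightarrow> {Neg (copy N i l), l} \<in> disj_clauses N U \<Phi>"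
| some_copy: "i < length \<Phi> \<Longrightarrow> l \<in> lits U \<Longrightarrow>
    {Neg (sel N i), Pos (copy N i l), Pos (copy N i (compl l))} \<in> disj_clauses N U \<Phi>"
| main_copy: "l \<in> lits U \<Longrightarrow>
    insert l ((\<lambda>i. Pos (copy N i (compl l))) ` {..<length \<Phi>}) \<in> disj_clauses N U \<Phi>"
| branch: "i < length \<Phi> \<Longrightarrow> D \<in> \<Phi> ! i \<Longrightarrow> g \<in> D \<Longrightarrow>
    insert (Neg (copy N i (compl g))) ((\<lambda>h. Pos (copy N i h)) ` (D - {g})) \<in> disj_clauses N U \<Phi>"

definition disj_aux :: "nat \<Rightarrow> var set \<Rightarrow> nat \<Rightarrow> var set" where
  "disj_aux N U k = sel N ` {..<k} \<union> (\<lambda>(i, l). copy N i l) ` ({..<k} \<times> lits U)"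

definition disj_encoding :: "nat \<Rightarrow> var set \<Rightarrow> cnf list \<Rightarrow> encoding" where
  "disj_encoding N U \<Phi> =
     \<lparr>main = U, aux = disj_aux N U (length \<Phi>), clauses = disj_clauses N U \<Phi>\<rparr>"

text \<open>The empty clause has no literal to single out and hence no \<open>branch\<close> clause,
  so the encoding would not notice it. Formulas containing it must be dropped beforehand.\<close>

locale pc_disjunction =
  fixes N :: nat and U :: "var set" and \<Phi> :: "cnf list"
  assumes U: "finite U" "x \<in> U \<Longrightarrow> x < N"
    and pc: "\<phi> \<in> set \<Phi> \<Longrightarrow> pc_encoding \<lparr>main = U, aux = {}, clauses = \<phi>\<rparr>"
    and nonempty: "\<phi> \<in> set \<Phi> \<Longrightarrow> {} \<notin> \<phi>"
begin

abbreviation "k \<equiv> length \<Phi>"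
abbreviation "s \<equiv> sel N"
abbreviation "c \<equiv> copy N"

lemma clause_lits: "i < k \<Longrightarrow> C \<in> \<Phi> ! i \<Longrightarrow> C \<subseteq> lits U"
  using pc[of "\<Phi> ! i"] by (auto simp: pc_encoding_def cnf_encoding_def)

lemma clause_nonempty: "i < k \<Longrightarrow> C \<in> \<Phi> ! i \<Longrightarrow> C \<noteq> {}"
  using nonempty[of "\<Phi> ! i"] by auto

lemma lits_disj_cases:
  assumes "m \<in> lits (U \<union> disj_aux N U k)"
  obtains "m \<in> lits U"
    | j where "j < k" "m = Pos (s j)" | j where "j < k" "m = Neg (s j)"
    | j l where "j < k" "l \<in> lits U" "m = Pos (c j l)"
    | j l where "j < k" "l \<in> lits U" "m = Neg (c j l)"
  using assms by (cases m) (auto simp: disj_aux_def)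

lemma cnf_encoding_disj: "cnf_encoding (disj_encoding N U \<Phi>)"
proof -
  have "U \<inter> disj_aux N U k = {}"
    using U(2) by (force simp: disj_aux_def)
  moreover have "finite (disj_aux N U k)"
    using U(1) by (auto simp: disj_aux_def)
  moreover have "C \<subseteq> lits (U \<union> disj_aux N U k)" if "C \<in> disj_clauses N U \<Phi>" for C
  proof -
    have aux: "s i \<in> disj_aux N U k" if "i < k" for i
      using that by (auto simp: disj_aux_def)
    have aux': "c i l \<in> disj_aux N U k" if "i < k" "l \<in> lits U" for i l
      using that by (force simp: disj_aux_def)
    have U': "l \<in> lits (U \<union> disj_aux N U k)" if "l \<in> lits U" for l
      using that by (auto simp: in_lits_iff)
    show ?thesis
      using \<open>C \<in> disj_clauses N U \<Phi>\<close>
    proof (cases rule: disj_clauses.cases)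
      case (branch i D g)
      then show ?thesis using clause_lits[OF branch(2,3)] aux' by auto
    qed (auto simp: aux aux' U')
  qed
  ultimately show ?thesis
    using U(1) by (auto simp: cnf_encoding_def disj_encoding_def)
qed

text \<open>The intended extension of a model \<open>a\<close> of the disjunct \<open>i\<close>.
  Values below \<open>N\<close> are kept even outside \<open>U\<close>, so that it still serves when
  main variables without occurrences are added.\<close>

definition model :: "assignment \<Rightarrow> nat \<Rightarrow> assignment" where
  "model a i v \<longleftrightarrow> (if v < N then a v else v = s i \<or> (\<exists>l\<in>lits U. v = c i l \<and> lit_true a l))"

lemma model_simps [simp]:
  "model a i (s j) \<longleftrightarrow> i = j"
  "model a i (c j l) \<longleftrightarrow> i = j \<and> l \<in> lits U \<and> lit_true a l"
  "x \<in> U \<Longrightarrow> model a i x \<longleftrightarrow> a x"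
  using U(2) by (auto simp: model_def)

lemma lit_true_model [simp]: "l \<in> lits U \<Longrightarrow> lit_true (model a i) l \<longleftrightarrow> lit_true a l"
  by (cases l) auto

lemma satisfies_model:
  assumes "i < k" "satisfies a (\<Phi> ! i)"
  shows "satisfies (model a i) (disj_clauses N U \<Phi>)"
  unfolding satisfies_def
proof
  fix C assume "C \<in> disj_clauses N U \<Phi>"
  then show "\<exists>l\<in>C. lit_true (model a i) l"
  proof (cases rule: disj_clauses.cases)
    case (main_copy l)
    then show ?thesis using assms(1) by (cases "lit_true a l") auto
  next
    case (branch j D g)
    show ?thesis
    proof (cases "j = i \<and> \<not> lit_true a g")
      case True
      then obtain h where "h \<in> D" "lit_true a h" "h \<in> lits U"
        using branch assms(2) clause_lits[of i D] by (auto simp: satisfies_def)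
      then show ?thesis using True branch by auto
    qed (use branch in auto)
  qed (use assms(1) in auto)
qed

text \<open>Some selector holds, and for that disjunct \<open>some_copy\<close> and
  \<open>copy_main\<close> make each copy equivalent to its literal. Then a \<open>branch\<close>
  clause says the same as the clause it comes from, whichever literal \<open>g\<close> is singled
  out.\<close>

lemma satisfies_branch:
  assumes "satisfies b (disj_clauses N U \<Phi>)"
  shows "\<exists>i<k. satisfies b (\<Phi> ! i)"
proof -
  have sat: "\<exists>l\<in>C. lit_true b l" if "C \<in> disj_clauses N U \<Phi>" for C
    using assms that by (auto simp: satisfies_def)
  obtain i where i: "i < k" "b (s i)"
    using sat[OF disj_clauses.some_sel] by auto
  have c: "b (c i l) \<longleftrightarrow> lit_true b l" if "l \<in> lits U" for l
    using sat[OF disj_clauses.some_copy[OF i(1) that]] sat[OF disj_clauses.copy_main[OF i(1) that]]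
      sat[OF disj_clauses.copy_main[OF i(1), of "compl l"]] that i(2) by auto
  have "\<exists>l\<in>C. lit_true b l" if C: "C \<in> \<Phi> ! i" for C
  proof -
    obtain g where g: "g \<in> C" using clause_nonempty[OF i(1) C] by blast
    from sat[OF disj_clauses.branch[OF i(1) C g]] show ?thesis
      using g clause_lits[OF i(1) C] by (auto simp: c subset_iff)
  qed
  with i(1) show ?thesis by (auto simp: satisfies_def)
qed

lemma disj_encoding_holds:
  "encoding_holds (disj_encoding N U \<Phi>) a \<longleftrightarrow> (\<exists>\<phi>\<in>set \<Phi>. satisfies a \<phi>)"
proof
  assume "encoding_holds (disj_encoding N U \<Phi>) a"
  then obtain b where b: "\<forall>v\<in>U. b v = a v" "satisfies b (disj_clauses N U \<Phi>)"
    by (auto simp: encoding_holds_def disj_encoding_def)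
  then obtain i where i: "i < k" "satisfies b (\<Phi> ! i)" using satisfies_branch by blast
  then have "satisfies a (\<Phi> ! i)"
    using satisfies_cong[of "\<Phi> ! i" U a b] clause_lits b(1) by auto
  with i show "\<exists>\<phi>\<in>set \<Phi>. satisfies a \<phi>" by auto
next
  assume "\<exists>\<phi>\<in>set \<Phi>. satisfies a \<phi>"
  then obtain i where "i < k" "satisfies a (\<Phi> ! i)" by (auto simp: in_set_conv_nth)
  then show "encoding_holds (disj_encoding N U \<Phi>) a"
    using satisfies_model[of i a] unfolding encoding_holds_def disj_encoding_def
    by (intro exI[of _ "model a i"]) auto
qed

section \<open>Models that extend a closed set of the disjunction encoding\<close>

context
  fixes \<beta> :: "lit set"
  assumes \<beta>: "\<beta> \<subseteq> lits (U \<union> disj_aux N U k)" and cl: "up_closed (disj_clauses N U \<Phi>) \<beta>"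
begin

lemma \<beta>_consistent: "l \<in> \<beta> \<Longrightarrow> compl l \<notin> \<beta>"
  using up_closed_consistent[OF cl] .

lemma sel_force: "i < k \<Longrightarrow> \<forall>j<k. j \<noteq> i \<longrightarrow> Neg (s j) \<in> \<beta> \<Longrightarrow> Pos (s i) \<in> \<beta>"
  by (rule up_closedD[OF cl disj_clauses.some_sel]) auto

lemma sel_unique: "i < k \<Longrightarrow> j < k \<Longrightarrow> i \<noteq> j \<Longrightarrow> Pos (s i) \<in> \<beta> \<Longrightarrow> Neg (s j) \<in> \<beta>"
  by (rule up_closedD[OF cl disj_clauses.unique_sel[of i _ j]]) auto

lemma dead_copy: "i < k \<Longrightarrow> l \<in> lits U \<Longrightarrow> Neg (s i) \<in> \<beta> \<Longrightarrow> Neg (c i l) \<in> \<beta>"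
  by (rule up_closedD[OF cl disj_clauses.copy_sel]) auto

lemma copy_sel: "i < k \<Longrightarrow> l \<in> lits U \<Longrightarrow> Pos (c i l) \<in> \<beta> \<Longrightarrow> Pos (s i) \<in> \<beta>"
  by (rule up_closedD[OF cl disj_clauses.copy_sel]) auto

lemma copy_main: "i < k \<Longrightarrow> l \<in> lits U \<Longrightarrow> Pos (c i l) \<in> \<beta> \<Longrightarrow> l \<in> \<beta>"
  by (rule up_closedD[OF cl disj_clauses.copy_main]) auto

lemma main_copy: "i < k \<Longrightarrow> l \<in> lits U \<Longrightarrow> l \<in> \<beta> \<Longrightarrow> Neg (c i (compl l)) \<in> \<beta>"
  by (rule up_closedD[OF cl disj_clauses.copy_main[of i _ "compl l"]]) auto

text \<open>A conflict inside the disjunct \<open>i\<close> is no contradiction in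
  \<open>\<beta>\<close>; it only refutes the selector.\<close>

lemma copies_dead:
  "i < k \<Longrightarrow> l \<in> lits U \<Longrightarrow> Neg (c i l) \<in> \<beta> \<Longrightarrow> Neg (c i (compl l)) \<in> \<beta> \<Longrightarrow> Neg (s i) \<in> \<beta>"
  by (rule up_closedD[OF cl disj_clauses.some_copy]) auto

lemma copy_force:
  "i < k \<Longrightarrow> l \<in> lits U \<Longrightarrow> Pos (s i) \<in> \<beta> \<Longrightarrow> Neg (c i (compl l)) \<in> \<beta> \<Longrightarrow> Pos (c i l) \<in> \<beta>"
  by (rule up_closedD[OF cl disj_clauses.some_copy]) auto

text \<open>This draws the conclusions common to all disjuncts. A refuted disjunct agrees with any
  of them, since by \<open>dead_copy\<close> all its copies are negated.\<close>

lemma main_force: "l \<in> lits U \<Longrightarrow> \<forall>i<k. Neg (c i (compl l)) \<in> \<beta> \<Longrightarrow> l \<in> \<beta>"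
  by (rule up_closedD[OF cl disj_clauses.main_copy]) auto

lemma clause_force:
  "i < k \<Longrightarrow> C \<in> \<Phi> ! i \<Longrightarrow> g \<in> C \<Longrightarrow> \<forall>h\<in>C. h \<noteq> g \<longrightarrow> Neg (c i h) \<in> \<beta> \<Longrightarrow>
     Neg (c i (compl g)) \<in> \<beta>"
  by (rule up_closedD[OF cl disj_clauses.branch]) auto

text \<open>The literals that \<open>\<beta>\<close> forces in the disjunct \<open>i\<close> in case it is selected.\<close>

definition proj :: "nat \<Rightarrow> lit set" where
  "proj i = {l \<in> lits U. Neg (c i (compl l)) \<in> \<beta>}"

text \<open>Makes the propagation completeness of the disjunct itself applicable. A complementary
  pair in \<open>proj i\<close> would refute the selector, and the \<open>branch\<close> clauses
  repeat on negated copies each propagation step of \<open>\<Phi> ! i\<close>.\<close>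

lemma up_closed_proj:
  assumes "i < k" "Neg (s i) \<notin> \<beta>"
  shows "up_closed (\<Phi> ! i) (proj i)"
  unfolding up_closed_def partial_assignment_def
proof (intro conjI ballI impI)
  show "compl l \<notin> proj i" if "l \<in> proj i" for l
    using that copies_dead[OF assms(1), of l] assms(2) by (auto simp: proj_def)
  show "{} \<notin> \<Phi> ! i" using clause_nonempty assms(1) by blast
  show "g \<in> proj i" if "C \<in> \<Phi> ! i" "g \<in> C" "\<forall>m\<in>C - {g}. compl m \<in> proj i" for C g
    using clause_force[OF assms(1) that(1,2)] that clause_lits[OF assms(1) that(1)]
    by (auto simp: proj_def)
qed

text \<open>A positive copy in \<open>\<beta>\<close> selects its disjunct and thereby refutes all
  others, so it can only belong to \<open>i\<close>. The negated copies of \<open>i\<close> are just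
  what \<open>proj i\<close> records, and those of other disjuncts are false in the model.\<close>

lemma model_extends:
  assumes i: "i < k" "Neg (s i) \<notin> \<beta>" and a: "\<forall>l\<in>proj i. lit_true a l" and m: "m \<in> \<beta>"
  shows "lit_true (model a i) m"
proof -
  from m \<beta> have "m \<in> lits (U \<union> disj_aux N U k)" by blast
  then show ?thesis
  proof (cases rule: lits_disj_cases)
    case 1
    then show ?thesis using main_copy[OF i(1), of m] m a by (auto simp: proj_def)
  next
    case (2 j)
    then show ?thesis using sel_unique[of j i] i m by auto
  next
    case (3 j)
    then show ?thesis using i m by auto
  next
    case (4 j l)
    then have "Pos (s j) \<in> \<beta>" "l \<in> \<beta>" using copy_sel copy_main m by auto
    then show ?thesis using sel_unique[of j i] main_copy[of i l] 4 i a by (auto simp: proj_def)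
  next
    case (5 j l)
    then have "compl l \<in> proj j" using m by (simp add: proj_def)
    then show ?thesis using a 5 by auto
  qed
qed

lemma live_model:
  assumes "i < k" "Neg (s i) \<notin> \<beta>"
  obtains a where "satisfies (model a i) (disj_clauses N U \<Phi>)" "\<forall>m\<in>\<beta>. lit_true (model a i) m"
proof -
  obtain a where "satisfies a (\<Phi> ! i)" "\<forall>m\<in>proj i. lit_true a m"
    using pc_encoding_model[of "\<lparr>main = U, aux = {}, clauses = \<Phi> ! i\<rparr>" "proj i"] pc assms
      up_closed_proj[OF assms] by (auto simp: proj_def)
  then show thesis using that satisfies_model model_extends assms by blast
qed

lemma live_model_not:
  assumes "i < k" "Neg (s i) \<notin> \<beta>" "l \<in> lits U" "Neg (c i (compl l)) \<notin> \<beta>"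
  obtains a where "satisfies (model a i) (disj_clauses N U \<Phi>)" "\<forall>m\<in>\<beta>. lit_true (model a i) m"
    "\<not> lit_true a l"
proof -
  obtain a where "satisfies a (\<Phi> ! i)" "\<forall>m\<in>proj i. lit_true a m" "\<not> lit_true a l"
    using pc_encoding_model_not[of "\<lparr>main = U, aux = {}, clauses = \<Phi> ! i\<rparr>" "proj i" l] pc assms
      up_closed_proj[OF assms(1,2)] by (auto simp: proj_def)
  then show thesis using that satisfies_model model_extends assms by blast
qed

text \<open>The model always comes from a disjunct whose selector is not refuted; which one to take
  is read off the contrapositive of the rule that would have propagated \<open>l\<close>.\<close>

lemma exists_model_not:
  assumes "l \<in> lits (U \<union> disj_aux N U k)" "l \<notin> \<beta>"
  shows "\<exists>b. satisfies b (disj_clauses N U \<Phi>) \<and> (\<forall>m\<in>\<beta>. lit_true b m) \<and> \<not> lit_true b l"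
proof -
  \<comment> \<open>If \<open>i\<close> is not forced, the clause \<open>some_sel\<close> has
    another selector that is not refuted, and a model of that disjunct leaves \<open>i\<close>
    unselected with all its copies false.\<close>
  have unselected: "\<exists>a j. j \<noteq> i \<and> satisfies (model a j) (disj_clauses N U \<Phi>) \<and> (\<forall>m\<in>\<beta>. lit_true (model a j) m)"
    if i: "i < k" "Pos (s i) \<notin> \<beta>" for i
  proof -
    from i obtain j where "j < k" "j \<noteq> i" "Neg (s j) \<notin> \<beta>"
      using sel_force[of i] by blast
    then show ?thesis using live_model[of j] by metis
  qed
  show ?thesis
    using assms(1)
  proof (cases rule: lits_disj_cases)
    case 1
    then obtain i where i: "i < k" "Neg (c i (compl l)) \<notin> \<beta>"
      using main_force[of l] assms(2) by blast
    then have "Neg (s i) \<notin> \<beta>" using dead_copy[of i "compl l"] 1 by auto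
    from live_model_not[OF i(1) this 1 i(2)] show ?thesis using 1 by (metis lit_true_model)
  next
    case (2 j)
    then show ?thesis using unselected[of j] assms(2) by (metis lit_true.simps(1) model_simps(1))
  next
    case (3 j)
    then show ?thesis using live_model[of j] assms(2) by (metis lit_true.simps(2) model_simps(1))
  next
    case (4 j g)
    show ?thesis
    proof (cases "Pos (s j) \<in> \<beta>")
      case True
      then have "Neg (s j) \<notin> \<beta>" using \<beta>_consistent[of "Pos (s j)"] by simp
      moreover have "Neg (c j (compl g)) \<notin> \<beta>" using copy_force 4 True assms(2) by blast
      ultimately show ?thesis
        using live_model_not[of j g] 4 by (metis lit_true.simps(1) model_simps(2))
    next
      case False
      then show ?thesis using unselected[of j] 4 by (metis lit_true.simps(1) model_simps(2))
    qed
  next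
    case (5 j g)
    then have "Neg (s j) \<notin> \<beta>" using dead_copy assms(2) by blast
    then obtain a where "satisfies (model a j) (disj_clauses N U \<Phi>)"
      "\<forall>m\<in>\<beta>. lit_true (model a j) m" "\<not> lit_true a (compl g)"
      using live_model_not[of j "compl g"] 5 assms(2) by auto
    then show ?thesis using 5 by (intro exI[of _ "model a j"]) auto
  qed
qed

end

lemma pc_encoding_disj: "pc_encoding (disj_encoding N U \<Phi>)"
  using cnf_encoding_disj exists_model_not
  by (intro pc_encodingI) (auto simp: disj_encoding_def)

end


section \<open>Size of the encoding of a disjunction\<close>

lemma cnf_size_mono: "finite B \<Longrightarrow> A \<subseteq> B \<Longrightarrow> cnf_size A \<le> cnf_size B"
  unfolding cnf_size_def by (rule sum_mono2) auto

lemma cnf_size_Un_le: "cnf_size (A \<union> B) \<le> cnf_size A + cnf_size B"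
  by (cases "finite A \<and> finite B") (auto simp: cnf_size_def sum_Un_nat)

lemma cnf_size_image_le:
  assumes "finite I" "\<And>i. i \<in> I \<Longrightarrow> card (f i) \<le> b"
  shows "cnf_size (f ` I) \<le> card I * b"
proof -
  have "cnf_size (f ` I) \<le> card (f ` I) * b"
    unfolding cnf_size_def using assms sum_bounded_above[of "f ` I" card b] by auto
  also have "\<dots> \<le> card I * b"
    using assms(1) by (simp add: card_image_le)
  finally show ?thesis .
qed

lemma card_insert_le_Suc: "card (insert x A) \<le> Suc (card A)"
  by (cases "finite A") (auto simp: card_insert_if)

lemma card_clause_le: "finite \<phi> \<Longrightarrow> C \<in> \<phi> \<Longrightarrow> card C \<le> cnf_size \<phi>"
  unfolding cnf_size_def by (rule member_le_sum) auto

text \<open>One summand for each introduction rule: the number of its instances times a bound on the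
  clause length, with at most \<open>2 * u\<close> literals over \<open>U\<close>. Instances of
  \<open>branch\<close> correspond to literal occurrences in the formulas, at most
  \<open>k * S\<close>, and each is no longer than the clause it comes from.\<close>

lemma cnf_size_disj_clauses_le:
  assumes U: "finite U" "card U \<le> u" and fin: "\<And>\<phi>. \<phi> \<in> set \<Phi> \<Longrightarrow> finite \<phi> \<and> (\<forall>C\<in>\<phi>. finite C)"
    and S: "\<And>\<phi>. \<phi> \<in> set \<Phi> \<Longrightarrow> cnf_size \<phi> \<le> S"
  defines "k \<equiv> length \<Phi>"
  shows "cnf_size (disj_clauses N U \<Phi>) \<le>
    k + k * k * 2 + k * (2 * u) * 2 + k * (2 * u) * 2 + k * (2 * u) * 3 + 2 * u * (1 + k) + k * S * S"
proof -
  define A1 where "A1 = (\<lambda>_::unit. (\<lambda>i. Pos (sel N i)) ` {..<k}) ` UNIV"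
  define A2 where "A2 = (\<lambda>(i, j). {Neg (sel N i), Neg (sel N j)}) ` ({..<k} \<times> {..<k})"
  define A3 where "A3 = (\<lambda>(i, l). {Neg (copy N i l), Pos (sel N i)}) ` ({..<k} \<times> lits U)"
  define A4 where "A4 = (\<lambda>(i, l). {Neg (copy N i l), l}) ` ({..<k} \<times> lits U)"
  define A5 where
    "A5 = (\<lambda>(i, l). {Neg (sel N i), Pos (copy N i l), Pos (copy N i (compl l))}) ` ({..<k} \<times> lits U)"
  define A6 where "A6 = (\<lambda>l. insert l ((\<lambda>i. Pos (copy N i (compl l))) ` {..<k})) ` lits U"
  define A7 where
    "A7 = (\<lambda>(i, D, g). insert (Neg (copy N i (compl g))) ((\<lambda>h. Pos (copy N i h)) ` (D - {g}))) `
       (SIGMA i:{..<k}. SIGMA D:\<Phi> ! i. D)"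
  have lits: "card (lits U) \<le> 2 * u"
    using card_lits_le[OF U(1)] U(2) by simp
  have fin': "finite (\<Phi> ! i)" "D \<in> \<Phi> ! i \<Longrightarrow> finite D" and S': "cnf_size (\<Phi> ! i) \<le> S"
    if "i < k" for i D
    using fin[of "\<Phi> ! i"] S[of "\<Phi> ! i"] that by (auto simp: k_def)
  have fin7: "finite (SIGMA i:{..<k}. SIGMA D:\<Phi> ! i. D)"
    using fin' by (intro finite_SigmaI) auto
  have "card (SIGMA i:{..<k}. SIGMA D:\<Phi> ! i. D) = (\<Sum>i<k. cnf_size (\<Phi> ! i))"
    using fin' by (simp add: card_SigmaI cnf_size_def finite_SigmaI)
  also have "\<dots> \<le> k * S"
    using sum_bounded_above[of "{..<k}" "\<lambda>i. cnf_size (\<Phi> ! i)" S] S' by simp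
  finally have card7: "card (SIGMA i:{..<k}. SIGMA D:\<Phi> ! i. D) \<le> k * S" .
  have "disj_clauses N U \<Phi> \<subseteq> A1 \<union> A2 \<union> A3 \<union> A4 \<union> A5 \<union> A6 \<union> A7"
  proof
    fix C assume "C \<in> disj_clauses N U \<Phi>"
    then show "C \<in> A1 \<union> A2 \<union> A3 \<union> A4 \<union> A5 \<union> A6 \<union> A7"
    proof cases
      case some_sel
      then have "C \<in> A1" by (auto simp: A1_def k_def)
      then show ?thesis by simp
    next
      case (unique_sel i j)
      then have "C \<in> A2" unfolding A2_def k_def by (intro image_eqI[of _ _ "(i, j)"]) auto
      then show ?thesis by simp
    next
      case (copy_sel i l)
      then have "C \<in> A3" unfolding A3_def k_def by (intro image_eqI[of _ _ "(i, l)"]) auto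
      then show ?thesis by simp
    next
      case (copy_main i l)
      then have "C \<in> A4" unfolding A4_def k_def by (intro image_eqI[of _ _ "(i, l)"]) auto
      then show ?thesis by simp
    next
      case (some_copy i l)
      then have "C \<in> A5" unfolding A5_def k_def by (intro image_eqI[of _ _ "(i, l)"]) auto
      then show ?thesis by simp
    next
      case (main_copy l)
      then have "C \<in> A6" unfolding A6_def k_def by (intro image_eqI[of _ _ l]) auto
      then show ?thesis by simp
    next
      case (branch i D g)
      then have "C \<in> A7" unfolding A7_def k_def by (intro image_eqI[of _ _ "(i, D, g)"]) auto
      then show ?thesis by simp
    qed
  qed
  then have "cnf_size (disj_clauses N U \<Phi>) \<le> cnf_size (A1 \<union> A2 \<union> A3 \<union> A4 \<union> A5 \<union> A6 \<union> A7)"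
    using U(1) fin7
    by (intro cnf_size_mono) (simp_all add: A1_def A2_def A3_def A4_def A5_def A6_def A7_def)
  also have "\<dots> \<le> cnf_size A1 + cnf_size A2 + cnf_size A3 + cnf_size A4 + cnf_size A5 + cnf_size A6 + cnf_size A7"
    by (intro order.trans[OF cnf_size_Un_le] add_mono order.refl)
  also have "\<dots> \<le> k + k * k * 2 + k * (2 * u) * 2 + k * (2 * u) * 2 + k * (2 * u) * 3 + 2 * u * (1 + k) + k * S * S"
  proof (intro add_mono)
    show "cnf_size A1 \<le> k"
      by (simp add: A1_def cnf_size_def UNIV_unit) (metis card_image_le card_lessThan finite_lessThan)
    have "cnf_size A2 \<le> card ({..<k} \<times> {..<k}) * 2"
      unfolding A2_def by (intro cnf_size_image_le) (auto simp: card_insert_if)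
    then show "cnf_size A2 \<le> k * k * 2" by simp
    have "cnf_size A3 \<le> card ({..<k} \<times> lits U) * 2"
      unfolding A3_def using U(1) by (intro cnf_size_image_le) (auto simp: card_insert_if)
    also have "\<dots> \<le> k * (2 * u) * 2"
      using mult_left_mono[OF lits, of k] by (simp add: card_cartesian_product)
    finally show "cnf_size A3 \<le> k * (2 * u) * 2" .
    have "cnf_size A4 \<le> card ({..<k} \<times> lits U) * 2"
      unfolding A4_def using U(1) by (intro cnf_size_image_le) (auto simp: card_insert_if)
    also have "\<dots> \<le> k * (2 * u) * 2"
      using mult_left_mono[OF lits, of k] by (simp add: card_cartesian_product)
    finally show "cnf_size A4 \<le> k * (2 * u) * 2" .
    have "cnf_size A5 \<le> card ({..<k} \<times> lits U) * 3"
      unfolding A5_def using U(1) by (intro cnf_size_image_le) (auto simp: card_insert_if)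
    also have "\<dots> \<le> k * (2 * u) * 3"
      using mult_left_mono[OF lits, of k] by (simp add: card_cartesian_product)
    finally show "cnf_size A5 \<le> k * (2 * u) * 3" .
    have "card (insert l ((\<lambda>i. Pos (copy N i (compl l))) ` {..<k})) \<le> 1 + k" for l
      using card_insert_le_Suc[of l "(\<lambda>i. Pos (copy N i (compl l))) ` {..<k}"]
        card_image_le[of "{..<k}" "\<lambda>i. Pos (copy N i (compl l))"] by simp
    then have "cnf_size A6 \<le> card (lits U) * (1 + k)"
      unfolding A6_def using U(1) by (intro cnf_size_image_le) auto
    also have "\<dots> \<le> 2 * u * (1 + k)" using lits by (rule mult_right_mono) simp
    finally show "cnf_size A6 \<le> 2 * u * (1 + k)" .
    have "card (insert (Neg (copy N i (compl g))) ((\<lambda>h. Pos (copy N i h)) ` (D - {g}))) \<le> S"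
      if "i < k" "D \<in> \<Phi> ! i" "g \<in> D" for i D g
    proof -
      have "card (insert (Neg (copy N i (compl g))) ((\<lambda>h. Pos (copy N i h)) ` (D - {g}))) \<le> Suc (card (D - {g}))"
        using card_insert_le_Suc[of "Neg (copy N i (compl g))" "(\<lambda>h. Pos (copy N i h)) ` (D - {g})"]
          card_image_le[of "D - {g}" "\<lambda>h. Pos (copy N i h)"] fin'(2)[OF that(1,2)] by simp
      also have "\<dots> = card D"
        using that fin' by (intro card_Suc_Diff1) auto
      also have "\<dots> \<le> S"
        using card_clause_le[OF fin'(1) that(2)] S' that by (meson order.trans)
      finally show ?thesis .
    qed
    then have "cnf_size A7 \<le> card (SIGMA i:{..<k}. SIGMA D:\<Phi> ! i. D) * S"
      unfolding A7_def using fin7 by (intro cnf_size_image_le) auto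
    also have "\<dots> \<le> k * S * S" using card7 by (rule mult_right_mono) simp
    finally show "cnf_size A7 \<le> k * S * S" .
  qed
  finally show ?thesis .
qed

lemma card_vars_le:
  assumes "finite \<phi>" "\<And>C. C \<in> \<phi> \<Longrightarrow> finite C"
  shows "card (lit_var ` \<Union>\<phi>) \<le> cnf_size \<phi>"
proof -
  have "card (lit_var ` \<Union>\<phi>) \<le> card (\<Union>\<phi>)"
    using assms by (intro card_image_le) auto
  also have "\<dots> \<le> cnf_size \<phi>"
    using card_UN_le[OF assms(1), of "\<lambda>C. C"] by (simp add: cnf_size_def)
  finally show ?thesis .
qed

section \<open>Decision trees\<close>

text \<open>Collapses a decision gate, with its two conjunctions and two literal leaves, into one
  constructor, so that later arguments are structural inductions.\<close>

datatype dtree = Tip encoding | Dec var dtree dtree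

fun dt_vars :: "dtree \<Rightarrow> var set" where
  "dt_vars (Tip e) = main e"
| "dt_vars (Dec x l r) = insert x (dt_vars l \<union> dt_vars r)"

fun dt_holds :: "dtree \<Rightarrow> assignment \<Rightarrow> bool" where
  "dt_holds (Tip e) a \<longleftrightarrow> encoding_holds e a"
| "dt_holds (Dec x l r) a \<longleftrightarrow> (if a x then dt_holds l a else dt_holds r a)"

fun dt_wf :: "dtree \<Rightarrow> bool" where
  "dt_wf (Tip e) \<longleftrightarrow> pc_encoding e \<and> aux e = {}"
| "dt_wf (Dec x l r) \<longleftrightarrow> x \<notin> dt_vars l \<union> dt_vars r \<and> dt_wf l \<and> dt_wf r"

text \<open>A decision gate contributes six edges and two literal leaves of size one.\<close>

fun dt_size :: "dtree \<Rightarrow> nat" where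
  "dt_size (Tip e) = encoding_size e"
| "dt_size (Dec x l r) = 8 + dt_size l + dt_size r"

section \<open>From circuit graphs to decision trees\<close>

definition reach :: "bdmc \<Rightarrow> nat \<Rightarrow> nat set" where
  "reach D v = {w. (v, w) \<in> (edges D)\<^sup>*}"

text \<open>Charges every edge to its source and every formula to its leaf, so that the size of the
  circuit is a sum over nodes.\<close>

definition node_weight :: "bdmc \<Rightarrow> nat \<Rightarrow> nat" where
  "node_weight D v = card (succs D v) + (if v \<in> leaves D then encoding_size (leaf D v) else 0)"

lemma reach_unfold: "reach D v = insert v (\<Union>w\<in>succs D v. reach D w)"
  by (auto simp: reach_def succs_def elim: converse_rtranclE intro: converse_rtrancl_into_rtrancl)

lemma var_of_unfold:
  assumes "v \<notin> leaves D"
  shows "var_of D v = (\<Union>w\<in>succs D v. var_of D w)"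
proof -
  have "var_of D v = (\<Union>w\<in>leaves D \<inter> reach D v. main (leaf D w))" for v
    by (auto simp: var_of_def reach_def)
  then show ?thesis
    using reach_unfold[of D v] assms by auto
qed

lemma var_of_leaf:
  assumes "v \<in> leaves D"
  shows "var_of D v = main (leaf D v)"
proof -
  have "reach D v = {v}"
    using reach_unfold[of D v] assms by (auto simp: leaves_def)
  moreover have "var_of D v = (\<Union>w\<in>leaves D \<inter> reach D v. main (leaf D w))"
    by (auto simp: var_of_def reach_def)
  ultimately show ?thesis using assms by auto
qed

lemma node_holds_iff:
  "node_holds D a v \<longleftrightarrow> (case label D v of
     Leaf e \<Rightarrow> encoding_holds e a
   | Or \<Rightarrow> (\<exists>w\<in>succs D v. node_holds D a w)
   | And \<Rightarrow> (\<forall>w\<in>succs D v. node_holds D a w))"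
  by (subst node_holds.simps) (auto split: node.splits)

lemma main_lit_encoding [simp]: "main (lit_encoding l) = {lit_var l}"
  by (cases l) auto

lemma encoding_holds_lit [simp]: "encoding_holds (lit_encoding l) a \<longleftrightarrow> lit_true a l"
  by (cases l) (auto simp: encoding_holds_def satisfies_def)

lemma encoding_size_lit [simp]: "encoding_size (lit_encoding l) = 1"
  by (cases l) (auto simp: encoding_size_def cnf_size_def)

locale backdoor_tree =
  fixes D :: bdmc
  assumes tree: "gen_pc_backdoor_tree D"
begin

lemma bdmc: "pc_bdmc D" and arb: "out_arborescence D"
  using tree by (auto simp: gen_pc_backdoor_tree_def)

lemma dag: "finite (nodes D)" "edges D \<subseteq> nodes D \<times> nodes D" "acyclic (edges D)"
    "root D \<in> nodes D" "v \<in> nodes D \<Longrightarrow> (root D, v) \<in> (edges D)\<^sup>*"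
  using bdmc by (auto simp: pc_bdmc_def rooted_dag_def)

lemma finite_edges: "finite (edges D)"
  using dag(1,2) by (meson finite_SigmaI finite_subset)

lemma finite_succs: "finite (succs D v)"
  by (rule finite_subset[OF _ dag(1)]) (use dag(2) in \<open>auto simp: succs_def\<close>)

lemma succs_nodes: "w \<in> succs D v \<Longrightarrow> w \<in> nodes D \<and> v \<in> nodes D"
  using dag(2) by (auto simp: succs_def)

lemma parent_unique:
  assumes "w \<in> succs D u" "w \<in> succs D v"
  shows "u = v"
proof -
  have "w \<in> nodes D - {root D}"
    using assms(1) arb succs_nodes[OF assms(1)] by (auto simp: out_arborescence_def succs_def)
  then show ?thesis
    using assms arb by (auto simp: out_arborescence_def succs_def)
qed

lemma leaf_label: "v \<in> nodes D \<Longrightarrow> is_Leaf (label D v) \<longleftrightarrow> v \<in> leaves D"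
  using bdmc by (auto simp: pc_bdmc_def)

lemma reach_nodes: "v \<in> nodes D \<Longrightarrow> reach D v \<subseteq> nodes D"
  using dag(2) by (auto simp: reach_def elim: rtranclE)

lemma finite_reach: "v \<in> nodes D \<Longrightarrow> finite (reach D v)"
  using reach_nodes dag(1) by (rule finite_subset)

lemma not_reach_parent:
  assumes "u \<in> succs D v"
  shows "v \<notin> reach D u"
proof
  assume "v \<in> reach D u"
  then have "(v, v) \<in> (edges D)\<^sup>+"
    using assms by (auto simp: reach_def succs_def intro: rtrancl_into_trancl2)
  then show False using dag(3) by (auto simp: acyclic_def)
qed

lemma reach_parent: "w \<in> reach D u \<Longrightarrow> w \<noteq> u \<Longrightarrow> w \<in> succs D v \<Longrightarrow> v \<in> reach D u"
  by (auto simp: reach_def elim!: rtranclE[of u w]) (metis parent_unique succs_def mem_Collect_eq)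

text \<open>Ancestors of a node form a chain because predecessors are unique: a nontrivial path from
  \<open>w\<close> to \<open>z\<close> must enter \<open>z\<close> through the same node
  \<open>y\<close> as the path from \<open>u\<close>, which allows induction along the
  latter.\<close>

lemma reach_comparable:
  assumes "z \<in> reach D u" "z \<in> reach D w"
  shows "u \<in> reach D w \<or> w \<in> reach D u"
proof -
  have "(u, z) \<in> (edges D)\<^sup>*" using assms(1) by (simp add: reach_def)
  then show ?thesis
    using assms(2)
  proof (induction rule: rtrancl_induct)
    case (step y z)
    show ?case
    proof (cases "w = z")
      case True
      then show ?thesis using step by (auto simp: reach_def intro: rtrancl_into_rtrancl)
    next
      case False
      then have "y \<in> reach D w"
        using reach_parent[of z w y] step by (simp add: succs_def)
      then show ?thesis by (rule step.IH)
    qed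
  qed simp
qed

text \<open>A common descendant would make one sibling reach the other, hence also reach their
  common predecessor, against acyclicity.\<close>

lemma siblings_disjoint:
  assumes "u \<in> succs D v" "w \<in> succs D v" "u \<noteq> w"
  shows "reach D u \<inter> reach D w = {}"
proof (rule ccontr)
  assume "reach D u \<inter> reach D w \<noteq> {}"
  then consider "u \<in> reach D w" | "w \<in> reach D u"
    using reach_comparable by blast
  then show False
    using reach_parent not_reach_parent assms by cases metis+
qed

definition weight :: "nat \<Rightarrow> nat" where
  "weight v = (\<Sum>w\<in>reach D v. node_weight D w)"

text \<open>Disjointness of sibling subtrees is what makes the size recursive. With shared nodes,
  the unfolded tree could be much larger than the graph.\<close>

lemma weight_unfold:
  assumes "v \<in> nodes D"
  shows "weight v = node_weight D v + (\<Sum>w\<in>succs D v. weight w)"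
proof -
  have "(\<Sum>w\<in>(\<Union>w\<in>succs D v. reach D w). node_weight D w) = (\<Sum>w\<in>succs D v. weight w)"
    unfolding weight_def
    using finite_succs finite_reach succs_nodes siblings_disjoint
    by (intro sum.UNION_disjoint) (auto; blast)+
  moreover have "finite (\<Union>w\<in>succs D v. reach D w)"
    using finite_succs finite_reach succs_nodes by auto
  moreover have "v \<notin> (\<Union>w\<in>succs D v. reach D w)"
    using not_reach_parent by auto
  ultimately show ?thesis
    unfolding weight_def by (subst reach_unfold) simp
qed

lemma weight_leaf: "v \<in> leaves D \<Longrightarrow> weight v = encoding_size (leaf D v)"
  using weight_unfold[of v] by (simp add: leaves_def node_weight_def)

lemma weight_root: "weight (root D) = bdmc_size D"
proof -
  have "reach D (root D) = nodes D"
    using reach_nodes[OF dag(4)] dag(5) by (auto simp: reach_def)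
  moreover have "edges D = (SIGMA v:nodes D. succs D v)"
    using dag(2) by (auto simp: succs_def)
  then have "card (edges D) = (\<Sum>v\<in>nodes D. card (succs D v))"
    using dag(1) finite_succs by (simp add: card_SigmaI)
  moreover have "(\<Sum>v\<in>nodes D. if v \<in> leaves D then encoding_size (leaf D v) else 0) =
      (\<Sum>v\<in>leaves D. encoding_size (leaf D v))"
    using dag(1) by (intro sum.mono_neutral_cong_right) (auto simp: leaves_def)
  ultimately show ?thesis
    by (simp add: weight_def node_weight_def bdmc_size_def sum.distrib)
qed

text \<open>The weight 3 is two edges and a literal leaf of size one. The other conjunct
  \<open>d\<close> is no conjunction, since its only predecessor would then be a disjunction and not
  \<open>u\<close>; the variable of \<open>l\<close> is absent below \<open>d\<close> by
  decomposability.\<close>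

lemma conj_with_litE:
  assumes "conj_with_lit D l u" "u \<in> nodes D"
  obtains d where "d \<in> succs D u" "label D d \<noteq> And" "lit_var l \<notin> var_of D d"
    "var_of D u = insert (lit_var l) (var_of D d)"
    "\<And>a. node_holds D a u \<longleftrightarrow> lit_true a l \<and> node_holds D a d" "weight u = 3 + weight d"
proof -
  obtain c d where cd: "label D u = And" "c \<noteq> d" "succs D u = {c, d}"
    "label D c = Leaf (lit_encoding l)"
    using assms(1) by (auto simp: conj_with_lit_def)
  have c: "c \<in> leaves D"
    using leaf_label[of c] succs_nodes[of c u] cd by simp
  then have var_c: "var_of D c = {lit_var l}" and weight_c: "weight c = 1"
    using var_of_leaf[OF c] weight_leaf[OF c] cd(4) by simp_all
  have u: "u \<notin> leaves D" using cd(3) by (simp add: leaves_def)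
  show thesis
  proof (rule that)
    show "d \<in> succs D u" using cd by simp
    show "label D d \<noteq> And"
    proof
      assume "label D d = And"
      then obtain u' where "decision_gate D u'" "d \<in> succs D u'"
        using tree succs_nodes[of d u] cd by (auto simp: gen_pc_backdoor_tree_def)
      moreover from this have "u' = u" using parent_unique cd by blast
      ultimately show False using cd(1) by (simp add: decision_gate_def)
    qed
    have "disjoint_family_on (var_of D) (succs D u)"
      using bdmc assms(2) cd(1) by (auto simp: pc_bdmc_def)
    then show "lit_var l \<notin> var_of D d"
      using cd var_c by (auto simp: disjoint_family_on_def)
    show "var_of D u = insert (lit_var l) (var_of D d)"
      using var_of_unfold[OF u] cd(3) var_c by simp
    show "node_holds D a u \<longleftrightarrow> lit_true a l \<and> node_holds D a d" for a
      using node_holds_iff[of D a u] node_holds_iff[of D a c] cd by simp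
    show "weight u = 3 + weight d"
      using weight_unfold[OF assms(2)] cd u weight_c by (simp add: node_weight_def)
  qed
qed

text \<open>Conjunctions are left out because they lie inside a decision gate and match no subtree
  of their own. A gate weighs 2 edges plus 3 for each conjunction, which gives the 8 in
  \<open>dt_size\<close>.\<close>

lemma exists_dtree_at:
  assumes "v \<in> nodes D" "label D v \<noteq> And"
  shows "\<exists>t. dt_wf t \<and> dt_vars t = var_of D v \<and> (\<forall>a. dt_holds t a \<longleftrightarrow> node_holds D a v) \<and>
    dt_size t \<le> weight v"
proof -
  \<comment> \<open>The transitive closure is needed because the induction skips the conjunctions
    and descends two edges at once.\<close>
  have "wf (((edges D)\<inverse>)\<^sup>+)"
    using finite_acyclic_wf_converse[OF finite_edges dag(3)] by (rule wf_trancl)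
  then show ?thesis
    using assms
  proof (induction v rule: wf_induct_rule)
    case (less v)
    show ?case
    proof (cases "label D v")
      case (Leaf e)
      then have v: "v \<in> leaves D" using leaf_label[of v] less.prems by simp
      then have "pc_encoding e" "aux e = {}"
        using bdmc tree Leaf by (force simp: pc_bdmc_def gen_pc_backdoor_tree_def)+
      then show ?thesis
        using Leaf var_of_leaf[OF v] weight_leaf[OF v] node_holds_iff[of D _ v]
        by (intro exI[of _ "Tip e"]) simp
    next
      case Or
      then have "decision_gate D v"
        using tree less.prems by (auto simp: gen_pc_backdoor_tree_def)
      then obtain x u w where uw: "u \<noteq> w" "succs D v = {u, w}"
        "conj_with_lit D (Pos x) u" "conj_with_lit D (Neg x) w"
        by (auto simp: decision_gate_def)
      have v: "v \<notin> leaves D" using uw by (simp add: leaves_def)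
      have nodes: "u \<in> nodes D" "w \<in> nodes D" using succs_nodes[of _ v] uw by auto
      obtain d where d: "d \<in> succs D u" "label D d \<noteq> And" "x \<notin> var_of D d"
        "var_of D u = insert x (var_of D d)"
        "\<And>a. node_holds D a u \<longleftrightarrow> a x \<and> node_holds D a d" "weight u = 3 + weight d"
        by (rule conj_with_litE[OF uw(3) nodes(1)]) auto
      obtain e where e: "e \<in> succs D w" "label D e \<noteq> And" "x \<notin> var_of D e"
        "var_of D w = insert x (var_of D e)"
        "\<And>a. node_holds D a w \<longleftrightarrow> \<not> a x \<and> node_holds D a e" "weight w = 3 + weight e"
        by (rule conj_with_litE[OF uw(4) nodes(2)]) auto
      have "(u, v) \<in> (edges D)\<inverse>" "(w, v) \<in> (edges D)\<inverse>" "(d, u) \<in> (edges D)\<inverse>" "(e, w) \<in> (edges D)\<inverse>"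
        using uw(2) d(1) e(1) by (auto simp: succs_def)
      then have lt: "(d, v) \<in> ((edges D)\<inverse>)\<^sup>+" "(e, v) \<in> ((edges D)\<inverse>)\<^sup>+"
        by (meson trancl.simps)+
      obtain l where l: "dt_wf l" "dt_vars l = var_of D d" "\<forall>a. dt_holds l a \<longleftrightarrow> node_holds D a d"
        "dt_size l \<le> weight d"
        using less.IH[OF lt(1) _ d(2)] succs_nodes[OF d(1)] by blast
      obtain r where r: "dt_wf r" "dt_vars r = var_of D e" "\<forall>a. dt_holds r a \<longleftrightarrow> node_holds D a e"
        "dt_size r \<le> weight e"
        using less.IH[OF lt(2) _ e(2)] succs_nodes[OF e(1)] by blast
      have "weight v = 2 + weight u + weight w"
        using weight_unfold[OF less.prems(1)] uw v by (simp add: node_weight_def)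
      moreover have "node_holds D a v \<longleftrightarrow> node_holds D a u \<or> node_holds D a w" for a
        using node_holds_iff[of D a v] Or uw(2) by simp
      ultimately show ?thesis
        using l r d e var_of_unfold[OF v] uw(2) by (intro exI[of _ "Dec x l r"]) auto
    qed (use less.prems in simp)
  qed
qed

lemma exists_dtree:
  "\<exists>t. dt_wf t \<and> dt_vars t = var_of D (root D) \<and>
    (\<forall>a. dt_holds t a \<longleftrightarrow> node_holds D a (root D)) \<and> dt_size t \<le> bdmc_size D"
proof -
  have "label D (root D) \<noteq> And"
  proof
    assume "label D (root D) = And"
    then obtain u where "root D \<in> succs D u"
      using tree dag(4) by (auto simp: gen_pc_backdoor_tree_def)
    then show False using arb by (auto simp: out_arborescence_def succs_def)
  qed
  then show ?thesis
    using exists_dtree_at[OF dag(4)] weight_root by simp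
qed

end

section \<open>Disjuncts of a decision tree and their common encoding\<close>

lemma encoding_holds_cong:
  "(\<And>v. v \<in> main e \<Longrightarrow> a v = b v) \<Longrightarrow> encoding_holds e a = encoding_holds e b"
  by (simp add: encoding_holds_def)

lemma dt_holds_cong:
  "(\<And>v. v \<in> dt_vars t \<Longrightarrow> a v = b v) \<Longrightarrow> dt_holds t a = dt_holds t b"
proof (induction t)
  case (Tip e)
  then show ?case using encoding_holds_cong[of e a b] by simp
qed auto

lemma encoding_holds_no_aux:
  assumes "cnf_encoding e" "aux e = {}"
  shows "encoding_holds e a \<longleftrightarrow> satisfies a (clauses e)"
proof -
  have "\<forall>C\<in>clauses e. C \<subseteq> lits (main e)"
    using assms by (simp add: cnf_encoding_def)
  then have "satisfies b (clauses e) \<longleftrightarrow> satisfies a (clauses e)" if "\<forall>v\<in>main e. b v = a v" for b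
    using that by (intro satisfies_cong) auto
  then show ?thesis
    unfolding encoding_holds_def by metis
qed

text \<open>A leaf formula with the empty clause represents falsity and contributes no disjunct, as
  required by the encoding of disjunctions.\<close>

fun branches :: "dtree \<Rightarrow> cnf list" where
  "branches (Tip e) = (if {} \<in> clauses e then [] else [clauses e])"
| "branches (Dec x l r) =
     map (insert {Pos x}) (branches l) @ map (insert {Neg x}) (branches r)"

lemma nonempty_branches: "\<phi> \<in> set (branches t) \<Longrightarrow> {} \<notin> \<phi>"
  by (induction t arbitrary: \<phi>) (auto split: if_splits)

lemma finite_dt_vars: "dt_wf t \<Longrightarrow> finite (dt_vars t)"
  by (induction t) (auto simp: pc_encoding_def cnf_encoding_def)

lemma satisfies_insert_unit [simp]:
  "satisfies a (insert {l} \<phi>) \<longleftrightarrow> lit_true a l \<and> satisfies a \<phi>"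
  by (simp add: satisfies_def)

lemma dt_holds_branches:
  "dt_wf t \<Longrightarrow> dt_holds t a \<longleftrightarrow> (\<exists>\<phi>\<in>set (branches t). satisfies a \<phi>)"
proof (induction t)
  case (Tip e)
  then have "encoding_holds e a \<longleftrightarrow> satisfies a (clauses e)"
    by (intro encoding_holds_no_aux) (auto simp: pc_encoding_def)
  moreover have "\<not> satisfies a (clauses e)" if "{} \<in> clauses e"
    using that by (auto simp: satisfies_def)
  ultimately show ?case by auto
next
  case (Dec x l r)
  then show ?case by (simp add: bex_Un)
qed

text \<open>At each decision the variables of the other subtree and \<open>x\<close> become main
  variables without occurrences, and then the unit clause of the decision is added. Both operations
  preserve propagation completeness.\<close>

lemma pc_encoding_branches:
  assumes "dt_wf t" "\<phi> \<in> set (branches t)"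
  shows "pc_encoding \<lparr>main = dt_vars t, aux = {}, clauses = \<phi>\<rparr>"
  using assms
proof (induction t arbitrary: \<phi>)
  case (Tip e)
  have e: "\<lparr>main = main e, aux = {}, clauses = clauses e\<rparr> = e"
    using Tip.prems(1) by (intro encoding.equality) simp_all
  have \<phi>: "\<phi> = clauses e"
    using Tip.prems(2) by (simp split: if_splits)
  show ?case
    unfolding \<phi> dt_vars.simps e using Tip.prems(1) by simp
next
  case (Dec x l r)
  have fin: "finite (insert x (dt_vars l \<union> dt_vars r))"
    using Dec.prems(1) finite_dt_vars by auto
  have "\<exists>\<psi> b. \<phi> = insert {lit_of x b} \<psi> \<and> (\<psi> \<in> set (branches l) \<or> \<psi> \<in> set (branches r))"
  proof -
    from Dec.prems(2) consider \<psi> where "\<psi> \<in> set (branches l)" "\<phi> = insert {lit_of x True} \<psi>"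
      | \<psi> where "\<psi> \<in> set (branches r)" "\<phi> = insert {lit_of x False} \<psi>"
      by (auto simp: lit_of_def)
    then show ?thesis by cases blast+
  qed
  then obtain \<psi> b where \<phi>: "\<phi> = insert {lit_of x b} \<psi>"
    and "\<psi> \<in> set (branches l) \<or> \<psi> \<in> set (branches r)"
    by blast
  then have "pc_encoding \<lparr>main = dt_vars l, aux = {}, clauses = \<psi>\<rparr> \<or>
      pc_encoding \<lparr>main = dt_vars r, aux = {}, clauses = \<psi>\<rparr>"
    using Dec.IH Dec.prems(1) by auto
  then have "pc_encoding \<lparr>main = insert x (dt_vars l \<union> dt_vars r), aux = {}, clauses = \<psi>\<rparr>"
    using pc_encoding_extend_main[OF _ _ fin] by auto
  then show ?case
    unfolding \<phi> by (simp add: pc_encoding_insert_unit)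
qed

lemma length_branches_le: "length (branches t) \<le> dt_size t + 1"
  by (induction t) auto

lemma cnf_size_insert_unit: "cnf_size (insert {l} \<phi>) \<le> Suc (cnf_size \<phi>)"
  by (cases "finite \<phi>"; cases "{l} \<in> \<phi>") (auto simp: cnf_size_def insert_absorb)

lemma cnf_size_branches_le: "\<phi> \<in> set (branches t) \<Longrightarrow> cnf_size \<phi> \<le> dt_size t"
proof (induction t arbitrary: \<phi>)
  case (Dec x l r)
  then obtain \<psi> m where "\<phi> = insert {m} \<psi>" "cnf_size \<psi> \<le> dt_size l \<or> cnf_size \<psi> \<le> dt_size r"
    by force
  then show ?case using cnf_size_insert_unit[of m \<psi>] by auto
qed (auto simp: encoding_size_def split: if_splits)

text \<open>
  Only variables that occur in the branches get copies, since the number of main variables is not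
  bounded in terms of the size.
\<close>

lemma exists_encoding_of_dtree:
  assumes wf: "dt_wf t"
  shows "\<exists>e. pc_encoding e \<and> main e = dt_vars t \<and> (\<forall>a. encoding_holds e a \<longleftrightarrow> dt_holds t a) \<and>
    encoding_size e \<le> 22 * (dt_size t + 1) ^ 3"
proof -
  define \<Phi> where "\<Phi> = branches t"
  define U where "U = (\<Union>\<phi>\<in>set \<Phi>. lit_var ` \<Union>\<phi>)"
  \<comment> \<open>The inserted 0 keeps the maximum meaningful for a tree without
    variables.\<close>
  define N where "N = Suc (Max (insert 0 (dt_vars t)))"
  define M where "M = dt_size t + 1"
  have N: "x < N" if "x \<in> dt_vars t" for x
    using that finite_dt_vars[OF wf] by (simp add: N_def less_Suc_eq_le Max_ge)
  have pc: "pc_encoding \<lparr>main = dt_vars t, aux = {}, clauses = \<phi>\<rparr>" if "\<phi> \<in> set \<Phi>" for \<phi>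
    using pc_encoding_branches[OF wf] that by (simp add: \<Phi>_def)
  have lits: "C \<subseteq> lits (dt_vars t)" if "\<phi> \<in> set \<Phi>" "C \<in> \<phi>" for \<phi> C
    using pc[OF that(1)] that(2) by (auto simp: pc_encoding_def cnf_encoding_def)
  have fin_lits: "finite (lits (dt_vars t))"
    using finite_dt_vars[OF wf] by simp
  have fin: "finite \<phi> \<and> (\<forall>C\<in>\<phi>. finite C)" if "\<phi> \<in> set \<Phi>" for \<phi>
    using lits[OF that] fin_lits
    by (meson PowI finite_Pow_iff finite_subset subsetI)
  have U_sub: "U \<subseteq> dt_vars t"
    using lits by (force simp: U_def in_lits_iff)
  then have fin_U: "finite U"
    using finite_dt_vars[OF wf] finite_subset by blast
  have pc_U: "pc_encoding \<lparr>main = U, aux = {}, clauses = \<phi>\<rparr>" if \<phi>: "\<phi> \<in> set \<Phi>" for \<phi>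
  proof (rule pc_encodingI, goal_cases)
    case 1
    have "C \<subseteq> lits U" if "C \<in> \<phi>" for C
      using that \<phi> unfolding U_def by (auto simp: in_lits_iff intro!: bexI[of _ \<phi>] imageI)
    then show ?case using fin_U by (simp add: cnf_encoding_def)
  next
    case (2 \<beta> l)
    then have sub: "\<beta> \<subseteq> lits (dt_vars t)" "l \<in> lits (dt_vars t)"
      using lits_mono[OF U_sub] by auto
    show ?case
      by (rule pc_encoding_model_not[OF pc[OF \<phi>], of \<beta> l]) (use sub 2 in auto)
  qed
  interpret pc_disjunction N U \<Phi>
    by unfold_locales (use fin_U U_sub N pc_U nonempty_branches \<Phi>_def in auto)
  have e: "disj_encoding N U \<Phi> = \<lparr>main = U, aux = disj_aux N U k, clauses = disj_clauses N U \<Phi>\<rparr>"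
    by (simp add: disj_encoding_def)
  let ?e = "\<lparr>main = dt_vars t, aux = disj_aux N U k, clauses = disj_clauses N U \<Phi>\<rparr>"
  show ?thesis
  proof (intro exI[of _ ?e] conjI allI)
    have "dt_vars t \<inter> disj_aux N U k = {}"
      using N by (force simp: disj_aux_def)
    then show "pc_encoding ?e"
      by (rule pc_encoding_extend_main[OF pc_encoding_disj[unfolded e] U_sub finite_dt_vars[OF wf]])
    show "main ?e = dt_vars t" by simp
    show "encoding_holds ?e a \<longleftrightarrow> dt_holds t a" for a
    proof
      assume "encoding_holds ?e a"
      then have "encoding_holds (disj_encoding N U \<Phi>) a"
        using U_sub by (auto simp: encoding_holds_def e)
      then show "dt_holds t a"
        using disj_encoding_holds[of a] by (simp add: dt_holds_branches[OF wf] \<Phi>_def)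
    next
      assume "dt_holds t a"
      then obtain i where i: "i < k" "satisfies a (\<Phi> ! i)"
        by (auto simp: dt_holds_branches[OF wf] \<Phi>_def in_set_conv_nth)
      have "model a i v = a v" if "v \<in> dt_vars t" for v
        using N[OF that] by (simp add: model_def)
      then show "encoding_holds ?e a"
        using satisfies_model[OF i] by (auto simp: encoding_holds_def)
    qed
    have k: "k \<le> M"
      using length_branches_le by (simp add: \<Phi>_def M_def)
    have S: "cnf_size \<phi> \<le> M" if "\<phi> \<in> set \<Phi>" for \<phi>
      using cnf_size_branches_le[of \<phi> t] that by (simp add: \<Phi>_def M_def)
    \<comment> \<open>At most \<open>M\<close> disjuncts, each with at most \<open>M\<close>
      occurring variables.\<close>
    have "card U \<le> (\<Sum>\<phi>\<in>set \<Phi>. card (lit_var ` \<Union>\<phi>))"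
      unfolding U_def by (rule card_UN_le) simp
    also have "\<dots> \<le> (\<Sum>\<phi>\<in>set \<Phi>. M)"
      using card_vars_le fin S by (intro sum_mono) (meson order.trans)
    also have "\<dots> \<le> M * M"
      using card_length[of \<Phi>] k by simp
    finally have u: "card U \<le> M * M" .
    have "cnf_size (disj_clauses N U \<Phi>) \<le> k + k * k * 2 + k * (2 * (M * M)) * 2 +
        k * (2 * (M * M)) * 2 + k * (2 * (M * M)) * 3 + 2 * (M * M) * (1 + k) + k * M * M"
      using fin_U u fin S by (rule cnf_size_disj_clauses_le)
    also have "\<dots> \<le> M + M * M * 2 + M * (2 * (M * M)) * 2 +
        M * (2 * (M * M)) * 2 + M * (2 * (M * M)) * 3 + 2 * (M * M) * (1 + M) + M * M * M"
      using k by (intro add_mono mult_mono) auto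
    also have "\<dots> = M + 4 * (M * M) + 17 * M ^ 3"
      by (simp add: power3_eq_cube algebra_simps)
    \<comment> \<open>Since \<open>M\<close> is positive, all powers are raised to the cube, and 1 +
      4 + 17 gives the 22.\<close>
    also have "\<dots> \<le> M ^ 3 + 4 * M ^ 3 + 17 * M ^ 3"
      by (intro add_mono mult_left_mono) (simp_all add: M_def power3_eq_cube)
    also have "\<dots> = 22 * M ^ 3"
      by simp
    finally show "encoding_size ?e \<le> 22 * (dt_size t + 1) ^ 3"
      by (simp add: encoding_size_def M_def)
  qed
qed

section \<open>Parity\<close>

text \<open>Toggling membership of a fixed \<open>x\<close> maps the sets of one parity injectively
  into those of the other, so at least half of all subsets are counted.\<close>

lemma card_wrong_parity:
  assumes "finite X" "X \<noteq> {}"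
  shows "2 ^ card X \<le> 2 * card {S \<in> Pow X. even (card S) \<noteq> b}" (is "_ \<le> 2 * card ?F")
proof -
  obtain x where x: "x \<in> X" using assms(2) by blast
  define t where "t S = (if x \<in> S then S - {x} else insert x S)" for S
  let ?G = "{S \<in> Pow X. even (card S) = b}"
  have "card ?G \<le> card ?F"
  proof (rule card_inj_on_le)
    show "inj_on t ?G"
      by (rule inj_on_inverseI[of _ t]) (auto simp: t_def)
    have "t S \<in> ?F" if "S \<in> ?G" for S
    proof -
      have "finite S" using that assms(1) finite_subset by blast
      then have "even (card (t S)) \<noteq> even (card S)"
      proof (cases "x \<in> S")
        case True
        then have "t S = S - {x}" "card S = Suc (card (S - {x}))"
          using card.remove[OF \<open>finite S\<close>] by (simp_all add: t_def)
        then show ?thesis by (metis even_Suc)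
      qed (simp add: t_def \<open>finite S\<close>)
      then show ?thesis using that x by (auto simp: t_def)
    qed
    then show "t ` ?G \<subseteq> ?F" by blast
  qed (use assms(1) in auto)
  moreover have "card (Pow X) = card ?G + card ?F"
    using assms(1) by (subst card_Un_disjoint[symmetric]) (auto intro: arg_cong[of _ _ card])
  ultimately show ?thesis using assms(1) by (simp add: card_Pow)
qed

text \<open>Each set \<open>S\<close> of wrong parity, read as an assignment, falsifies some clause
  \<open>g S\<close>. If \<open>Neg x\<close> were missing from it for some \<open>x\<close> in
  \<open>S\<close>, then removing \<open>x\<close> would keep the clause false although the parity
  becomes right. So \<open>S\<close> can be read off the negative literals of \<open>g S\<close>,
  which makes \<open>g\<close> injective and gives as many clauses as wrong sets.\<close>

lemma parity_cnf_size_ge: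
  assumes X: "finite X" "X \<noteq> {}" and \<phi>: "finite \<phi>" "\<And>C. C \<in> \<phi> \<Longrightarrow> finite C"
    and par: "\<And>a. satisfies a \<phi> \<longleftrightarrow> even (card {x \<in> X. a x}) = b"
  shows "2 ^ card X \<le> 2 * cnf_size \<phi>"
proof -
  define F where "F = {S \<in> Pow X. even (card S) \<noteq> b}"
  have sub: "{x \<in> X. x \<in> S} = S" if "S \<subseteq> X" for S
    using that by auto
  have "\<exists>C\<in>\<phi>. \<forall>l\<in>C. \<not> lit_true (\<lambda>v. v \<in> S) l" if "S \<in> F" for S
    using that par[of "\<lambda>v. v \<in> S"] by (auto simp: F_def satisfies_def sub)
  then obtain g where g: "\<And>S. S \<in> F \<Longrightarrow> g S \<in> \<phi>" "\<And>S l. S \<in> F \<Longrightarrow> l \<in> g S \<Longrightarrow> \<not> lit_true (\<lambda>v. v \<in> S) l"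
    by metis
  have "{x \<in> X. Neg x \<in> g S} = S" if S: "S \<in> F" for S
  proof (intro equalityI subsetI)
    fix x assume "x \<in> {x \<in> X. Neg x \<in> g S}"
    then show "x \<in> S" using g(2)[OF S, of "Neg x"] by auto
  next
    fix x assume x: "x \<in> S"
    have "finite S" "S \<subseteq> X" using S X(1) finite_subset by (auto simp: F_def)
    have "Neg x \<in> g S"
    proof (rule ccontr)
      assume neg: "Neg x \<notin> g S"
      have "\<not> lit_true (\<lambda>v. v \<in> S - {x}) l" if "l \<in> g S" for l
        using g(2)[OF S that] that neg by (cases l) auto
      then have "\<not> satisfies (\<lambda>v. v \<in> S - {x}) \<phi>"
        using g(1)[OF S] by (auto simp: satisfies_def)
      moreover have "{y \<in> X. y \<in> S - {x}} = S - {x}"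
        using \<open>S \<subseteq> X\<close> by (intro sub) auto
      ultimately have "even (card (S - {x})) \<noteq> b"
        using par[of "\<lambda>v. v \<in> S - {x}"] by metis
      moreover have "card S = Suc (card (S - {x}))"
        using card_Suc_Diff1[OF \<open>finite S\<close> x] by simp
      ultimately show False using S by (auto simp: F_def)
    qed
    then show "x \<in> {x \<in> X. Neg x \<in> g S}" using x \<open>S \<subseteq> X\<close> by auto
  qed
  then have "inj_on g F"
    by (intro inj_on_inverseI[of _ "\<lambda>C. {x \<in> X. Neg x \<in> C}"])
  then have "card F \<le> card \<phi>"
    using g(1) \<phi>(1) by (intro card_inj_on_le) auto
  also have "card \<phi> \<le> cnf_size \<phi>"
  proof -
    obtain x where x: "x \<in> X" using X(2) by blast
    \<comment> \<open>An assignment of the right parity, showing that the formula is satisfiable and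
      hence that each clause contributes at least one literal.\<close>
    define a where "a v \<longleftrightarrow> v = x \<and> \<not> b" for v
    have "{y \<in> X. a y} = (if b then {} else {x})" using x by (auto simp: a_def)
    then have "satisfies a \<phi>" using par[of a] by simp
    then have "C \<noteq> {}" if "C \<in> \<phi>" for C using that by (auto simp: satisfies_def)
    then have "1 \<le> card C" if "C \<in> \<phi>" for C
      using that \<phi>(2) by (simp add: Suc_le_eq card_gt_0_iff)
    then show ?thesis
      unfolding cnf_size_def using sum_bounded_below[of \<phi> 1 card] by simp
  qed
  finally show ?thesis
    using card_wrong_parity[OF X, of b] by (simp add: F_def)
qed

text \<open>Both subtrees compute parity of the remaining variables, so the induction needs
  arbitrary \<open>X\<close> and either value of \<open>b\<close>. The summand 2 covers leaves of
  size zero when \<open>X\<close> is empty; adding the bounds of two subtrees doubles it, which the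
  8 of a decision absorbs.\<close>

lemma parity_dt_size_ge:
  assumes "dt_wf t" "finite X" "\<And>a. dt_holds t a \<longleftrightarrow> even (card {x \<in> X. a x}) = b"
  shows "2 ^ card X \<le> 2 * dt_size t + 2"
  using assms
proof (induction t arbitrary: X b)
  case (Tip e)
  then have e: "cnf_encoding e" "aux e = {}" by (auto simp: pc_encoding_def)
  show ?case
  proof (cases "X = {}")
    case False
    have lits: "clauses e \<subseteq> Pow (lits (main e))" "finite (lits (main e))"
      using e by (auto simp: cnf_encoding_def)
    then have "finite (clauses e)" "\<And>C. C \<in> clauses e \<Longrightarrow> finite C"
      by (auto intro: finite_subset)
    moreover have "satisfies a (clauses e) \<longleftrightarrow> even (card {x \<in> X. a x}) = b" for a
      using Tip(3)[of a] encoding_holds_no_aux[OF e] by simp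
    ultimately have "2 ^ card X \<le> 2 * cnf_size (clauses e)"
      using parity_cnf_size_ge[OF Tip(2) False] by blast
    then show ?thesis by (simp add: encoding_size_def)
  qed simp
next
  case (Dec x l r)
  then have x: "x \<notin> dt_vars l" "x \<notin> dt_vars r" and wf: "dt_wf l" "dt_wf r" by auto
  let ?Y = "X - {x}"
  \<comment> \<open>Setting \<open>x\<close> to true flips the required parity exactly if
    \<open>x\<close> counts; the subtree itself cannot read \<open>x\<close>.\<close>
  have l: "dt_holds l a \<longleftrightarrow> even (card {y \<in> ?Y. a y}) = (b = (x \<notin> X))" for a
  proof -
    have "dt_holds l a = dt_holds l (a(x := True))"
      using x by (intro dt_holds_cong) auto
    also have "\<dots> \<longleftrightarrow> even (card {y \<in> X. (a(x := True)) y}) = b"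
      using Dec.prems(3)[of "a(x := True)"] by (simp add: fun_upd_same del: fun_upd_apply)
    also have "{y \<in> X. (a(x := True)) y} = (if x \<in> X then insert x {y \<in> ?Y. a y} else {y \<in> ?Y. a y})"
      by auto
    also have "even (card \<dots>) = (even (card {y \<in> ?Y. a y}) = (x \<notin> X))"
    proof (cases "x \<in> X")
      case True
      have "card (insert x {y \<in> ?Y. a y}) = Suc (card {y \<in> ?Y. a y})"
        using Dec.prems(2) by (intro card_insert_disjoint) auto
      then show ?thesis using True by simp
    qed simp
    finally show ?thesis by auto
  qed
  have r: "dt_holds r a \<longleftrightarrow> even (card {y \<in> ?Y. a y}) = b" for a
  proof -
    have "dt_holds r a = dt_holds r (a(x := False))"
      using x by (intro dt_holds_cong) auto
    also have "\<dots> \<longleftrightarrow> even (card {y \<in> X. (a(x := False)) y}) = b"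
      using Dec.prems(3)[of "a(x := False)"] by (simp add: fun_upd_same del: fun_upd_apply)
    also have "{y \<in> X. (a(x := False)) y} = {y \<in> ?Y. a y}"
      by auto
    finally show ?thesis .
  qed
  have "2 ^ card ?Y \<le> 2 * dt_size l + 2" "2 ^ card ?Y \<le> 2 * dt_size r + 2"
    using Dec.IH(1)[OF wf(1) _ l] Dec.IH(2)[OF wf(2) _ r] Dec.prems(2) by auto
  moreover have "card X \<le> Suc (card ?Y)"
  proof (cases "x \<in> X")
    case True
    show ?thesis using card.remove[OF Dec.prems(2) True] by (rule eq_imp_le)
  qed simp
  then have "(2::nat) ^ card X \<le> 2 ^ Suc (card ?Y)"
    by (intro power_increasing) auto
  ultimately show ?case by simp
qed

section \<open>A propagation complete encoding of parity\<close>

definition xv :: "nat \<Rightarrow> var" where "xv i = 2 * i"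
definition yv :: "nat \<Rightarrow> var" where "yv i = 2 * i + 1"

lemma xv_yv_simps [simp]:
  "xv i = xv j \<longleftrightarrow> i = j" "yv i = yv j \<longleftrightarrow> i = j" "xv i \<noteq> yv j" "yv j \<noteq> xv i"
  unfolding xv_def yv_def by (simp, simp, presburger+)

text \<open>The auxiliary variable \<open>yv i\<close> is the parity of the first \<open>i\<close> main variables.\<close>

definition chain_clauses :: "nat \<Rightarrow> cnf" where
  "chain_clauses n = {{Neg (yv 0)}, {Pos (yv n)}} \<union>
     (\<lambda>(i, p, q). {lit_of (yv i) (\<not> p), lit_of (xv i) (\<not> q), lit_of (yv (Suc i)) (p \<noteq> q)}) `
       ({..<n} \<times> UNIV)"

definition chain_encoding :: "nat \<Rightarrow> encoding" where
  "chain_encoding n = \<lparr>main = xv ` {..<n}, aux = yv ` {..n}, clauses = chain_clauses n\<rparr>"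

lemma chain_clauseI:
  "i < n \<Longrightarrow>
    {lit_of (yv i) (\<not> p), lit_of (xv i) (\<not> q), lit_of (yv (Suc i)) (p \<noteq> q)} \<in> chain_clauses n"
  unfolding chain_clauses_def by (intro UnI2 image_eqI[of _ _ "(i, p, q)"]) auto

lemma chain_clauseE:
  assumes "C \<in> chain_clauses n"
  obtains "C = {Neg (yv 0)}" | "C = {Pos (yv n)}"
  | i p q where "i < n" "C = {lit_of (yv i) (\<not> p), lit_of (xv i) (\<not> q), lit_of (yv (Suc i)) (p \<noteq> q)}"
  using assms by (auto simp: chain_clauses_def)

lemma cnf_encoding_chain: "cnf_encoding (chain_encoding n)"
  unfolding cnf_encoding_def chain_encoding_def
  by (auto elim!: chain_clauseE)

lemma satisfies_chain_clauses:
  "satisfies a (chain_clauses n) \<longleftrightarrow>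
     \<not> a (yv 0) \<and> a (yv n) \<and> (\<forall>i<n. a (yv (Suc i)) \<longleftrightarrow> a (yv i) \<noteq> a (xv i))" (is "_ \<longleftrightarrow> ?R")
proof
  assume sat: "satisfies a (chain_clauses n)"
  have "a (yv (Suc i)) \<longleftrightarrow> a (yv i) \<noteq> a (xv i)" if "i < n" for i
  proof -
    \<comment> \<open>In the clause with these signs the first two literals are false under
      \<open>a\<close>, so the third must hold.\<close>
    have "\<exists>l\<in>{lit_of (yv i) (\<not> a (yv i)), lit_of (xv i) (\<not> a (xv i)), lit_of (yv (Suc i)) (a (yv i) \<noteq> a (xv i))}.
        lit_true a l"
      using sat chain_clauseI[OF that] unfolding satisfies_def by blast
    then show ?thesis by auto
  qed
  moreover have "{Neg (yv 0)} \<in> chain_clauses n" "{Pos (yv n)} \<in> chain_clauses n"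
    by (auto simp: chain_clauses_def)
  then have "\<not> a (yv 0)" "a (yv n)"
    using sat by (force simp: satisfies_def)+
  ultimately show ?R by blast
next
  assume ?R
  then show "satisfies a (chain_clauses n)"
    unfolding satisfies_def by (auto elim!: chain_clauseE)
qed

lemma card_xv_Suc:
  "card {x \<in> xv ` {..<Suc i}. a x} = card {x \<in> xv ` {..<i}. a x} + (if a (xv i) then 1 else 0)"
proof -
  have "{x \<in> xv ` {..<Suc i}. a x} =
      (if a (xv i) then insert (xv i) {x \<in> xv ` {..<i}. a x} else {x \<in> xv ` {..<i}. a x})"
    by (auto simp: lessThan_Suc)
  moreover have "xv i \<notin> {x \<in> xv ` {..<i}. a x}" by auto
  then have "card (insert (xv i) {x \<in> xv ` {..<i}. a x}) = Suc (card {x \<in> xv ` {..<i}. a x})"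
    by (rule card_insert_disjoint[rotated]) simp
  ultimately show ?thesis by simp
qed

lemma chain_encoding_holds:
  "encoding_holds (chain_encoding n) a \<longleftrightarrow> odd (card {x \<in> xv ` {..<n}. a x})"
proof
  assume "encoding_holds (chain_encoding n) a"
  then obtain b where b: "\<forall>v\<in>xv ` {..<n}. b v = a v" "\<not> b (yv 0)" "b (yv n)"
    "\<forall>i<n. b (yv (Suc i)) \<longleftrightarrow> b (yv i) \<noteq> b (xv i)"
    by (auto simp: encoding_holds_def chain_encoding_def satisfies_chain_clauses)
  have "b (yv i) \<longleftrightarrow> odd (card {x \<in> xv ` {..<i}. a x})" if "i \<le> n" for i
    using that by (induction i) (use b in \<open>auto simp: card_xv_Suc\<close>)
  with b(3) show "odd (card {x \<in> xv ` {..<n}. a x})" by blast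
next
  assume odd: "odd (card {x \<in> xv ` {..<n}. a x})"
  define b where "b v \<longleftrightarrow> (if even v then a v else odd (card {x \<in> xv ` {..<v div 2}. a x}))" for v
  have "b (xv i) = a (xv i)" "b (yv i) \<longleftrightarrow> odd (card {x \<in> xv ` {..<i}. a x})" for i
    by (simp_all add: b_def xv_def yv_def)
  then show "encoding_holds (chain_encoding n) a"
    unfolding encoding_holds_def chain_encoding_def
    using odd by (intro exI[of _ b]) (auto simp: satisfies_chain_clauses card_xv_Suc)
qed

lemma lit_of_unassigned: "lit_of v b \<notin> \<beta> \<Longrightarrow> compl (lit_of v b) \<notin> \<beta> \<Longrightarrow> lit_of v c \<notin> \<beta>"
  by (cases "c = b") auto

context
  fixes \<beta> :: "lit set" and n :: nat
  assumes cl: "up_closed (chain_clauses n) \<beta>"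
begin

lemma chain_consistent: "lit_of v p \<in> \<beta> \<Longrightarrow> lit_of v q \<in> \<beta> \<Longrightarrow> p = q"
  using up_closed_consistent[OF cl, of "lit_of v p"] by (cases "p = q") auto

lemma chain_ends: "lit_of (yv 0) False \<in> \<beta>" "lit_of (yv n) True \<in> \<beta>"
  using up_closedD[OF cl, of "{Neg (yv 0)}"] up_closedD[OF cl, of "{Pos (yv n)}"]
  by (auto simp: chain_clauses_def lit_of_def)

lemma chain_force:
  assumes "i < n"
  shows "lit_of (yv i) p \<in> \<beta> \<Longrightarrow> lit_of (xv i) q \<in> \<beta> \<Longrightarrow> lit_of (yv (Suc i)) (p \<noteq> q) \<in> \<beta>"
    and "lit_of (yv i) p \<in> \<beta> \<Longrightarrow> lit_of (yv (Suc i)) q \<in> \<beta> \<Longrightarrow> lit_of (xv i) (p \<noteq> q) \<in> \<beta>"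
    and "lit_of (xv i) p \<in> \<beta> \<Longrightarrow> lit_of (yv (Suc i)) q \<in> \<beta> \<Longrightarrow> lit_of (yv i) (p \<noteq> q) \<in> \<beta>"
proof -
  note force = up_closedD[OF cl chain_clauseI[OF assms]]
  show "lit_of (yv (Suc i)) (p \<noteq> q) \<in> \<beta>" if "lit_of (yv i) p \<in> \<beta>" "lit_of (xv i) q \<in> \<beta>"
    by (rule force[of _ p q]) (use that in auto)
  show "lit_of (xv i) (p \<noteq> q) \<in> \<beta>" if "lit_of (yv i) p \<in> \<beta>" "lit_of (yv (Suc i)) q \<in> \<beta>"
    \<comment> \<open>The instance is picked so that its last literal is the one that
      \<open>lit_of (yv (Suc i)) q\<close> refutes.\<close>
    by (rule force[of _ p "p = q"]) (use that in \<open>auto simp: lit_of_def split: if_splits\<close>)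
  show "lit_of (yv i) (p \<noteq> q) \<in> \<beta>" if "lit_of (xv i) p \<in> \<beta>" "lit_of (yv (Suc i)) q \<in> \<beta>"
    by (rule force[of _ "p = q" p]) (use that in \<open>auto simp: lit_of_def split: if_splits\<close>)
qed

text \<open>
  The parities along the chain when they follow \<open>\<beta>\<close> where it determines them and the arbitrary
  choice \<open>c\<close> elsewhere.
\<close>

primrec val :: "(nat \<Rightarrow> bool) \<Rightarrow> nat \<Rightarrow> bool" where
  "val c 0 = False"
| "val c (Suc i) =
    (if \<exists>b. lit_of (yv (Suc i)) b \<in> \<beta> then lit_of (yv (Suc i)) True \<in> \<beta>
     else if \<exists>b. lit_of (xv i) b \<in> \<beta> then val c i \<noteq> (lit_of (xv i) True \<in> \<beta>)
     else c (Suc i))"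

lemma val_cong: "(\<And>j. j \<le> i \<Longrightarrow> c j = d j) \<Longrightarrow> val c i = val d i"
  by (induction i) auto

lemma val_yv: "lit_of (yv i) b \<in> \<beta> \<Longrightarrow> val c i = b"
  using chain_ends(1) by (cases i) (use chain_consistent in \<open>auto; metis\<close>)+

text \<open>If the next parity is fixed by \<open>\<beta>\<close>, then so is the current one by
  propagation, and both values are followed. Otherwise the next parity is computed from
  \<open>lit_of (xv i) q\<close>.\<close>

lemma val_xv:
  assumes "i < n" "lit_of (xv i) q \<in> \<beta>"
  shows "(val c i \<noteq> val c (Suc i)) = q"
proof (cases "\<exists>b. lit_of (yv (Suc i)) b \<in> \<beta>")
  case True
  then obtain b where b: "lit_of (yv (Suc i)) b \<in> \<beta>" by blast
  from val_yv[OF chain_force(3)[OF assms b]] val_yv[OF b] show ?thesis by auto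
next
  case False
  then show ?thesis
    using assms(2) chain_consistent[of "xv i" q True] by (cases q) auto
qed

text \<open>Walking back from an unassigned parity over assigned main variables meets only
  unassigned parities, since propagation would otherwise have continued. The walk must stop at a
  free choice because \<open>yv 0\<close> is assigned, and the choice is carried forward by
  exclusive ors with constants.\<close>

lemma val_flip:
  assumes "i \<le> n" "\<nexists>b. lit_of (yv i) b \<in> \<beta>"
  shows "val (\<lambda>_. True) i \<noteq> val (\<lambda>_. False) i"
  using assms
proof (induction i)
  case 0
  then show ?case using chain_ends(1) by blast
next
  case (Suc i)
  show ?case
  proof (cases "\<exists>b. lit_of (xv i) b \<in> \<beta>")
    case True
    then have "\<nexists>b. lit_of (yv i) b \<in> \<beta>" using chain_force(1)[of i] Suc.prems by auto
    then show ?thesis using Suc True by auto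
  qed (use Suc.prems in auto)
qed

text \<open>Main variables are differences of consecutive parities, so the exclusive-or constraints
  hold for every choice \<open>c\<close>. Main variables are even and auxiliary ones odd, and
  halving recovers the index.\<close>

definition chain_model :: "(nat \<Rightarrow> bool) \<Rightarrow> assignment" where
  "chain_model c v \<longleftrightarrow>
    (if even v then val c (v div 2) \<noteq> val c (Suc (v div 2)) else val c (v div 2))"

lemma chain_model_simps [simp]:
  "chain_model c (xv i) \<longleftrightarrow> val c i \<noteq> val c (Suc i)" "chain_model c (yv i) \<longleftrightarrow> val c i"
  by (simp_all add: chain_model_def xv_def yv_def del: val.simps)

lemma satisfies_chain_model: "satisfies (chain_model c) (chain_clauses n)"
  using val_yv[OF chain_ends(2)] by (auto simp: satisfies_chain_clauses simp del: val.simps(2))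

lemma chain_lits_cases:
  assumes "l \<in> lits (xv ` {..<n} \<union> yv ` {..n})"
  obtains i b where "i < n" "l = lit_of (xv i) b" | i b where "i \<le> n" "l = lit_of (yv i) b"
  using assms by (cases l rule: lit_cases_of) auto

lemma chain_model_extends:
  "m \<in> \<beta> \<Longrightarrow> m \<in> lits (xv ` {..<n} \<union> yv ` {..n}) \<Longrightarrow> lit_true (chain_model c) m"
  by (erule chain_lits_cases) (use val_xv val_yv in \<open>simp_all del: val.simps\<close>)

text \<open>An unassigned parity can be flipped by \<open>val_flip\<close>. For an unassigned
  \<open>xv i\<close>, propagation cannot have fixed both adjacent parities: if the later one is
  fixed, the earlier one is flipped, and otherwise the later one is chosen freely.\<close>

lemma chain_model_not:
  assumes "l \<in> lits (xv ` {..<n} \<union> yv ` {..n})" "l \<notin> \<beta>"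
  shows "\<exists>c. \<not> lit_true (chain_model c) l"
proof (cases "compl l \<in> \<beta>")
  case True
  then show ?thesis
    using chain_model_extends[OF True, of "\<lambda>_. False"] assms(1) by auto
next
  case unassigned: False
  show ?thesis
    using assms(1)
  proof (cases rule: chain_lits_cases)
    case (2 i b)
    then have "\<nexists>b. lit_of (yv i) b \<in> \<beta>"
      using assms(2) unassigned lit_of_unassigned by blast
    with val_flip 2 show ?thesis
      by (cases "val (\<lambda>_. True) i = b") (auto intro: exI[of _ "\<lambda>_. False"] exI[of _ "\<lambda>_. True"])
  next
    case (1 i q)
    then have free: "\<nexists>b. lit_of (xv i) b \<in> \<beta>"
      using assms(2) unassigned lit_of_unassigned by blast
    show ?thesis
    proof (cases "\<exists>b. lit_of (yv (Suc i)) b \<in> \<beta>")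
      case True
      then obtain r where r: "lit_of (yv (Suc i)) r \<in> \<beta>" by blast
      then have "\<nexists>b. lit_of (yv i) b \<in> \<beta>"
        using chain_force(2)[OF 1(1)] free by blast
      then have "val (\<lambda>_. True) i \<noteq> val (\<lambda>_. False) i"
        using val_flip 1 by simp
      moreover have "val c (Suc i) = r" for c
        by (rule val_yv[OF r])
      ultimately show ?thesis
        unfolding 1 lit_true_lit_of chain_model_simps by metis
    next
      case False
      define v where "v = val (\<lambda>_. False) i"
      \<comment> \<open>The choice at \<open>Suc i\<close> makes the difference to \<open>v\<close>
        opposite to \<open>q\<close>; earlier parities do not depend on it.\<close>
      define c where "c = (\<lambda>_. False)(Suc i := (v = q))"
      have "val c i = v"
        unfolding v_def by (rule val_cong) (simp add: c_def)
      moreover have "val c (Suc i) \<longleftrightarrow> v = q"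
        using False free by (simp add: c_def)
      ultimately have "(val c i \<noteq> val c (Suc i)) \<noteq> q" by auto
      then show ?thesis
        unfolding 1 lit_true_lit_of chain_model_simps by blast
    qed
  qed
qed

end

lemma pc_encoding_chain: "pc_encoding (chain_encoding n)"
proof (rule pc_encodingI[OF cnf_encoding_chain], goal_cases)
  case (1 \<beta> l)
  then obtain c where "\<not> lit_true (chain_model \<beta> c) l"
    using chain_model_not[of n \<beta> l] by (auto simp: chain_encoding_def)
  then show ?case
    using 1 satisfies_chain_model[of n \<beta> c] chain_model_extends[of n \<beta> _ c]
    by (auto simp: chain_encoding_def)
qed

section \<open>Exponential against polynomial growth\<close>

lemma poly_le_power:
  fixes p :: "real poly"
  shows "\<exists>c d. 0 \<le> c \<and> (\<forall>x\<ge>0. poly p x \<le> c * (x + 1) ^ d)"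
proof (induction p)
  case 0
  show ?case by (intro exI[of _ 0]) auto
next
  case (pCons a p)
  then obtain c d where cd: "0 \<le> c" "\<forall>x\<ge>0. poly p x \<le> c * (x + 1) ^ d" by blast
  have "poly (pCons a p) x \<le> (\<bar>a\<bar> + c) * (x + 1) ^ Suc d" if "0 \<le> x" for x
  proof -
    have "a \<le> \<bar>a\<bar> * (x + 1) ^ Suc d"
      using mult_left_mono[OF one_le_power[of "x + 1" "Suc d"], of "\<bar>a\<bar>"] that by simp
    moreover have "x * poly p x \<le> (x + 1) * (c * (x + 1) ^ d)"
    proof -
      have "x * poly p x \<le> x * (c * (x + 1) ^ d)"
        using cd that by (intro mult_left_mono) auto
      also have "\<dots> \<le> (x + 1) * (c * (x + 1) ^ d)"
        using cd that by (intro mult_right_mono) auto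
      finally show ?thesis .
    qed
    ultimately show ?thesis by (simp add: algebra_simps)
  qed
  with cd(1) show ?case by (intro exI[of _ "\<bar>a\<bar> + c"] exI[of _ "Suc d"]) auto
qed

lemma exists_exp_gt_poly:
  fixes c :: real
  assumes "0 \<le> c"
  shows "\<exists>n::nat. 2 * (c * (12 * real n + 3) ^ d) + 2 < 2 ^ n"
proof -
  \<comment> \<open>For positive \<open>n\<close>, \<open>12 * n + 3\<close> is at most
    \<open>15 * n\<close>; the factor \<open>1 / ln 2\<close> comes from writing
    \<open>2 ^ n\<close> as \<open>exp (y n)\<close>. The 2 later added to \<open>K\<close> absorbs
    the constant summand, as \<open>y n\<close> is at least 1.\<close>
  define K where "K = 2 * c * (15 / ln 2) ^ d"
  define y where "y n = ln 2 * real n" for n :: nat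
  have "0 \<le> K" using assms by (simp add: K_def)
  have y_top: "filterlim y at_top sequentially"
    unfolding y_def
    by (rule filterlim_tendsto_pos_mult_at_top[OF tendsto_const _ filterlim_real_sequentially]) simp
  then have "(\<lambda>n. (K + 2) * (y n ^ d / exp (y n))) \<longlonglongrightarrow> (K + 2) * 0"
    by (intro tendsto_mult tendsto_const filterlim_compose[OF tendsto_power_div_exp_0])
  then have "eventually (\<lambda>n. (K + 2) * (y n ^ d / exp (y n)) < 1) sequentially"
    by (intro order_tendstoD(2)) auto
  moreover have "eventually (\<lambda>n. 1 \<le> y n) sequentially"
    using y_top by (simp add: filterlim_at_top)
  ultimately have "eventually (\<lambda>n. 1 \<le> y n \<and> (K + 2) * (y n ^ d / exp (y n)) < 1 \<and> 1 \<le> n) sequentially"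
    using eventually_ge_at_top[of 1] by eventually_elim auto
  then obtain n where n: "1 \<le> y n" "(K + 2) * (y n ^ d / exp (y n)) < 1" "1 \<le> n"
    by (auto dest: eventually_happens)
  have exp_y: "exp (y n) = 2 ^ n"
    by (simp add: y_def mult.commute[of "ln 2"] exp_of_nat_mult)
  have "(12 * real n + 3) ^ d \<le> (15 * real n) ^ d"
    using n(3) by (intro power_mono) auto
  also have "15 * real n = 15 / ln 2 * y n"
    by (simp add: y_def)
  finally have "2 * (c * (12 * real n + 3) ^ d) \<le> 2 * (c * (15 / ln 2 * y n) ^ d)"
    using assms by (intro mult_left_mono) auto
  also have "\<dots> = K * y n ^ d"
    by (simp only: K_def power_mult_distrib mult_ac)
  finally have "2 * (c * (12 * real n + 3) ^ d) + 2 \<le> (K + 2) * y n ^ d"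
    using one_le_power[OF n(1), of d] by (simp add: distrib_right)
  also have "\<dots> < 2 ^ n"
    using n(2) by (simp add: exp_y field_simps)
  finally show ?thesis by blast
qed

section \<open>Comparison of the languages\<close>

definition single_leaf :: "encoding \<Rightarrow> bdmc" where
  "single_leaf e = \<lparr>nodes = {0}, edges = {}, root = 0, label = (\<lambda>_. Leaf e)\<rparr>"

lemma single_leaf:
  shows "pc_encoding e \<Longrightarrow> pc_bdmc (single_leaf e)"
    and "bdmc_fun (single_leaf e) = encoding_fun e"
    and "bdmc_size (single_leaf e) = encoding_size e"
proof -
  have leaves: "leaves (single_leaf e) = {0}"
    by (simp add: leaves_def succs_def single_leaf_def)
  have var: "var_of (single_leaf e) 0 = main e"
    using var_of_leaf[of 0 "single_leaf e"] leaves by (simp add: single_leaf_def)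
  show "pc_bdmc (single_leaf e)" if "pc_encoding e"
    using that leaves var
    by (auto simp: pc_bdmc_def rooted_dag_def single_leaf_def acyclic_def disjoint_family_on_def
        pc_encoding_def cnf_encoding_def)
  show "bdmc_fun (single_leaf e) = encoding_fun e"
    using var node_holds_iff[of "single_leaf e" _ 0]
    by (auto simp: bdmc_fun_def encoding_fun_def single_leaf_def)
  show "bdmc_size (single_leaf e) = encoding_size e"
    using leaves by (simp add: bdmc_size_def single_leaf_def)
qed

lemma bdmcs_succinct: "at_least_as_succinct PC_BDMCs gen_PC_backdoor_trees"
  unfolding at_least_as_succinct_def
  by (rule exI[of _ "[:0, 1:]"])
     (auto simp: PC_BDMCs_def gen_PC_backdoor_trees_def gen_pc_backdoor_tree_def)

lemma encodings_succinct: "at_least_as_succinct PC_encodings gen_PC_backdoor_trees"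
  unfolding at_least_as_succinct_def
proof (intro exI[of _ "smult 22 ([:1, 1:] ^ 3)"] ballI)
  fix D assume "D \<in> sentences gen_PC_backdoor_trees"
  then interpret backdoor_tree D
    by unfold_locales (simp add: gen_PC_backdoor_trees_def)
  obtain t where t: "dt_wf t" "dt_vars t = var_of D (root D)"
    "\<forall>a. dt_holds t a \<longleftrightarrow> node_holds D a (root D)" "dt_size t \<le> bdmc_size D"
    using exists_dtree by blast
  obtain e where e: "pc_encoding e" "main e = dt_vars t" "\<forall>a. encoding_holds e a \<longleftrightarrow> dt_holds t a"
    "encoding_size e \<le> 22 * (dt_size t + 1) ^ 3"
    using exists_encoding_of_dtree[OF t(1)] by blast
  have "encoding_size e \<le> 22 * (bdmc_size D + 1) ^ 3"
    using e(4) t(4) by (meson add_le_mono1 le_trans mult_le_mono2 power_mono zero_le)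
  then have "real (encoding_size e) \<le> real (22 * (bdmc_size D + 1) ^ 3)"
    by (rule of_nat_mono)
  then show "\<exists>\<psi>\<in>sentences PC_encodings. represents PC_encodings \<psi> = represents gen_PC_backdoor_trees D \<and>
      real (sentence_size PC_encodings \<psi>) \<le>
        poly (smult 22 ([:1, 1:] ^ 3)) (real (sentence_size gen_PC_backdoor_trees D))"
    using e t
    by (intro bexI[of _ e])
       (auto simp: PC_encodings_def gen_PC_backdoor_trees_def encoding_fun_def bdmc_fun_def add.commute)
qed

text \<open>Four clauses of three literals for each exclusive or, and two units for the ends of the
  chain.\<close>

lemma encoding_size_chain_le: "encoding_size (chain_encoding n) \<le> 12 * n + 2"
proof -
  let ?f = "\<lambda>(i, p, q). {lit_of (yv i) (\<not> p), lit_of (xv i) (\<not> q), lit_of (yv (Suc i)) (p \<noteq> q)}"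
  have "cnf_size (?f ` ({..<n} \<times> UNIV)) \<le> card ({..<n} \<times> (UNIV :: (bool \<times> bool) set)) * 3"
    by (rule cnf_size_image_le) (auto simp: card_insert_if)
  moreover have "cnf_size {{Neg (yv 0)}, {Pos (yv n)}} = 2"
    by (simp add: cnf_size_def)
  ultimately show ?thesis
    using cnf_size_Un_le[of "{{Neg (yv 0)}, {Pos (yv n)}}" "?f ` ({..<n} \<times> UNIV)"]
    by (simp add: encoding_size_def chain_encoding_def chain_clauses_def card_cartesian_product
        card_UNIV_bool flip: UNIV_Times_UNIV)
qed

lemma backdoor_tree_for_chain_large:
  assumes "gen_pc_backdoor_tree D" "bdmc_fun D = encoding_fun (chain_encoding n)"
  shows "2 ^ n \<le> 2 * bdmc_size D + 2"
proof -
  interpret backdoor_tree D using assms(1) by unfold_locales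
  obtain t where t: "dt_wf t" "\<forall>a. dt_holds t a \<longleftrightarrow> node_holds D a (root D)" "dt_size t \<le> bdmc_size D"
    using exists_dtree by blast
  have parity: "dt_holds t a \<longleftrightarrow> even (card {x \<in> xv ` {..<n}. a x}) = False" for a
  proof -
    have "node_holds D a (root D) \<longleftrightarrow> encoding_holds (chain_encoding n) a"
      using assms(2) by (simp add: bdmc_fun_def encoding_fun_def fun_eq_iff)
    then show ?thesis by (simp add: t(2) chain_encoding_holds)
  qed
  have "2 ^ card (xv ` {..<n}) \<le> 2 * dt_size t + 2"
    by (rule parity_dt_size_ge[OF t(1), where b = False]) (simp, rule parity)
  moreover have "card (xv ` {..<n}) = n"
    by (simp add: card_image inj_on_def)
  ultimately show ?thesis using t(3) by simp
qed

text \<open>Stated for any language that expresses the chain encodings without loss of size, so that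
  it applies to PC encodings and, by single leaves, to PC-BDMCs.\<close>

lemma trees_not_succinct:
  fixes L :: "'s language"
  assumes "\<And>n. \<exists>\<phi>\<in>sentences L. represents L \<phi> = encoding_fun (chain_encoding n) \<and>
    sentence_size L \<phi> = encoding_size (chain_encoding n)"
  shows "\<not> at_least_as_succinct gen_PC_backdoor_trees L"
proof
  assume "at_least_as_succinct gen_PC_backdoor_trees L"
  then obtain p :: "real poly" where p: "\<forall>\<phi>\<in>sentences L. \<exists>D\<in>sentences gen_PC_backdoor_trees.
      represents gen_PC_backdoor_trees D = represents L \<phi> \<and>
      real (sentence_size gen_PC_backdoor_trees D) \<le> poly p (real (sentence_size L \<phi>))"
    unfolding at_least_as_succinct_def by blast
  \<comment> \<open>The size of the chain encoding is only bounded from above and \<open>p\<close>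
    need not be monotone, so \<open>p\<close> is replaced by a monotone bound.\<close>
  obtain c d where cd: "0 \<le> c" "\<forall>x\<ge>0. poly p x \<le> c * (x + 1) ^ d"
    using poly_le_power by blast
  obtain n where n: "2 * (c * (12 * real n + 3) ^ d) + 2 < 2 ^ n"
    using exists_exp_gt_poly[OF cd(1)] by blast
  obtain D where D: "gen_pc_backdoor_tree D" "bdmc_fun D = encoding_fun (chain_encoding n)"
    "real (bdmc_size D) \<le> poly p (real (encoding_size (chain_encoding n)))"
  proof -
    obtain \<phi> where \<phi>: "\<phi> \<in> sentences L" "represents L \<phi> = encoding_fun (chain_encoding n)"
      "sentence_size L \<phi> = encoding_size (chain_encoding n)"
      using assms[of n] by blast
    from bspec[OF p \<phi>(1)] show thesis
      unfolding \<phi>(2,3) by (auto simp: gen_PC_backdoor_trees_def intro: that)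
  qed
  have "poly p (real (encoding_size (chain_encoding n))) \<le>
      c * (real (encoding_size (chain_encoding n)) + 1) ^ d"
    using cd(2) by simp
  also have "\<dots> \<le> c * (12 * real n + 3) ^ d"
    using encoding_size_chain_le[of n] cd(1) by (intro mult_left_mono power_mono) auto
  finally have "2 * real (bdmc_size D) + 2 < 2 ^ n"
    using n D(3) by linarith
  moreover have "real (2 ^ n) \<le> real (2 * bdmc_size D + 2)"
    using backdoor_tree_for_chain_large[OF D(1,2)] by (rule of_nat_mono)
  ultimately show False by simp
qed

theorem theorem4p2:
  "strictly_more_succinct PC_BDMCs gen_PC_backdoor_trees \<and>
   strictly_more_succinct PC_encodings gen_PC_backdoor_trees"
proof -
  have "\<not> at_least_as_succinct gen_PC_backdoor_trees PC_BDMCs"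
    using pc_encoding_chain single_leaf
    by (intro trees_not_succinct) (auto simp: PC_BDMCs_def intro!: exI[of _ "single_leaf (chain_encoding _)"])
  moreover have "\<not> at_least_as_succinct gen_PC_backdoor_trees PC_encodings"
    using pc_encoding_chain
    by (intro trees_not_succinct) (auto simp: PC_encodings_def)
  ultimately show ?thesis
    using bdmcs_succinct encodings_succinct by (simp add: strictly_more_succinct_def)
qed

end
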